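(* Let $\lambda_0\in\mathbb{C}$ with $a=|\operatorname{Im}(\lambda_0)|\neq 0$, let $\alpha>0$, and let $A\in\mathbb{C}$ be non-zero. For a doubly infinite sequence $\{T_k\}_{k\in\mathbb{Z}}$ of exponential tempered distributions of type $a$ on $\mathbb{R}$ consider the conditions (1) for all $k\in\mathbb{Z}$: $\left(\frac{d}{dx}-i\lambda_0+\alpha\right)T_k=A T_{k+1}$ if $\operatorname{Im}(\lambda_0)>0$, and $\left(\frac{d}{dx}-i\lambda_0-\alpha\right)T_k=A T_{k+1}$ if $\operatorname{Im}(\lambda_0)<0$; (2) there exist a seminorm $\gamma$ on $S^a(\mathbb{R})$ and a constant $M>0$ such that $|\langle T_k,f\rangle|\le M\gamma(f)$ for all $f\in S^a(\mathbb{R})$ and all $k\in\mathbb{Z}$. Then the following hold. (a) If $|A|=\alpha$, then every sequence $\{T_k\}_{k\in\mathbb{Z}}$ satisfying (1) and (2) satisfies $\frac{d}{dx}T_0=i\lambda_0 T_0$. (b) If $|A|<\alpha$, then every sequence $\{T_k\}_{k\in\mathbb{Z}}$ satisfying (1) and (2) satisfies $T_k=0$ for all $k\in\mathbb{Z}$. (c) If $|A|>\alpha$, then there exists a sequence $\{T_k\}_{k\in\mathbb{Z}}$ satisfying (1) and (2) such that $T_0$ is not an eigendistribution of $\frac{d}{dx}$ (i.e. there is no $\mu\in\mathbb{C}$ with $\frac{d}{dx}T_0=\mu T_0$).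
   Context: For $a\ge 0$, $S^a(\mathbb{R})$ is the space of all $C^\infty$ functions $f:\mathbb{R}\to\mathbb{C}$ such that $$\gamma_{m,n}(f)=\sup_{x\in\mathbb{R}} e^{a|x|}(1+|x|)^m\left|\frac{d^n f}{dx^n}(x)\right|<\infty$$ for all non-negative integers $m,n$. It is a Fréchet space with the topology induced by the seminorms $\gamma_{m,n}$; "seminorm on $S^a(\mathbb{R})$" refers to this topology. Its (continuous) dual $S^a(\mathbb{R})'$ is called the space of exponential tempered distributions of type $a$ on $\mathbb{R}$, and $\langle\cdot,\cdot\rangle$ is the dual bracket. For $T\in S^a(\mathbb{R})'$, $\frac{d}{dx}T$ is the usual distributional derivative: $\left\langle\frac{d}{dx}T,\psi\right\rangle=-\left\langle T,\frac{d\psi}{dx}\right\rangle$ for $\psi\in S^a(\mathbb{R})$. *)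

theory Defs
  imports "HOL-Analysis.Analysis"
begin

definition D :: "(real \<Rightarrow> complex) \<Rightarrow> real \<Rightarrow> complex" where
  "D f = (\<lambda>x. vector_derivative f (at x))"

definition smooth :: "(real \<Rightarrow> complex) \<Rightarrow> bool" where
  "smooth f \<longleftrightarrow> (\<forall>n x. ((D ^^ n) f) differentiable (at x))"

definition weighted :: "real \<Rightarrow> nat \<Rightarrow> nat \<Rightarrow> (real \<Rightarrow> complex) \<Rightarrow> real \<Rightarrow> real" where
  "weighted a m n f x = exp (a * \<bar>x\<bar>) * (1 + \<bar>x\<bar>) ^ m * cmod ((D ^^ n) f x)"

definition exp_schwartz :: "real \<Rightarrow> (real \<Rightarrow> complex) set" where
  "exp_schwartz a = {f. smooth f \<and> (\<forall>m n. bdd_above (range (weighted a m n f)))}"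

text \<open>A real supremum, meaningful only when it is finite, i.e. on \<open>exp_schwartz a\<close>.\<close>

definition gam :: "real \<Rightarrow> nat \<Rightarrow> nat \<Rightarrow> (real \<Rightarrow> complex) \<Rightarrow> real" where
  "gam a m n f = (SUP x. weighted a m n f x)"

text \<open>The locally convex topology induced by the seminorms \<open>gam a m n\<close>: the balls of the
  individual seminorms, around arbitrary centres, form a subbase.\<close>

definition exp_schwartz_topology :: "real \<Rightarrow> (real \<Rightarrow> complex) topology" where
  "exp_schwartz_topology a = topology_generated_by
     {{g \<in> exp_schwartz a. gam a m n (\<lambda>x. g x - f x) < e} | f m n e.
        f \<in> exp_schwartz a \<and> 0 < e}"

definition continuous_seminorm :: "real \<Rightarrow> ((real \<Rightarrow> complex) \<Rightarrow> real) \<Rightarrow> bool" where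
  "continuous_seminorm a p \<longleftrightarrow>
     (\<forall>f\<in>exp_schwartz a. 0 \<le> p f) \<and>
     (\<forall>f\<in>exp_schwartz a. \<forall>g\<in>exp_schwartz a. p (\<lambda>x. f x + g x) \<le> p f + p g) \<and>
     (\<forall>c. \<forall>f\<in>exp_schwartz a. p (\<lambda>x. c * f x) = cmod c * p f) \<and>
     continuous_map (exp_schwartz_topology a) euclideanreal p"

text \<open>A functional on \<open>exp_schwartz a\<close> is represented by a total function whose values outside
  \<open>exp_schwartz a\<close> are irrelevant; hence equality of distributions is \<open>dist_eq\<close>, not \<open>=\<close>.\<close>

type_synonym functional = "(real \<Rightarrow> complex) \<Rightarrow> complex"

definition exp_tempered :: "real \<Rightarrow> functional \<Rightarrow> bool" where
  "exp_tempered a T \<longleftrightarrow>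
     (\<forall>f\<in>exp_schwartz a. \<forall>g\<in>exp_schwartz a. T (\<lambda>x. f x + g x) = T f + T g) \<and>
     (\<forall>c. \<forall>f\<in>exp_schwartz a. T (\<lambda>x. c * f x) = c * T f) \<and>
     continuous_map (exp_schwartz_topology a) euclidean T"

definition dist_eq :: "real \<Rightarrow> functional \<Rightarrow> functional \<Rightarrow> bool" where
  "dist_eq a T U \<longleftrightarrow> (\<forall>\<psi>\<in>exp_schwartz a. T \<psi> = U \<psi>)"

definition dist_deriv :: "functional \<Rightarrow> functional" where
  "dist_deriv T = (\<lambda>\<psi>. - T (D \<psi>))"

definition recurrence :: "complex \<Rightarrow> real \<Rightarrow> complex \<Rightarrow> (int \<Rightarrow> functional) \<Rightarrow> bool" where
  "recurrence l0 \<alpha> A T \<longleftrightarrow>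
     (\<forall>k. (Im l0 > 0 \<longrightarrow> dist_eq \<bar>Im l0\<bar>
              (\<lambda>\<psi>. dist_deriv (T k) \<psi> - \<i> * l0 * T k \<psi> + of_real \<alpha> * T k \<psi>)
              (\<lambda>\<psi>. A * T (k + 1) \<psi>)) \<and>
          (Im l0 < 0 \<longrightarrow> dist_eq \<bar>Im l0\<bar>
              (\<lambda>\<psi>. dist_deriv (T k) \<psi> - \<i> * l0 * T k \<psi> - of_real \<alpha> * T k \<psi>)
              (\<lambda>\<psi>. A * T (k + 1) \<psi>)))"

definition uniformly_bounded :: "real \<Rightarrow> (int \<Rightarrow> functional) \<Rightarrow> bool" where
  "uniformly_bounded a T \<longleftrightarrow>
     (\<exists>p M. continuous_seminorm a p \<and> M > 0 \<and>
        (\<forall>k. \<forall>f\<in>exp_schwartz a. cmod (T k f) \<le> M * p f))"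

end

theory Submission
  imports Defs
    "HOL-Complex_Analysis.Cauchy_Integral_Formula"
    "HOL-Probability.Sinc_Integral"
    "HOL-Real_Asymp.Real_Asymp"
begin

text \<open>
Write \<open>\<sigma>\<close> for the sign of \<open>Im l0\<close> and \<open>L = \<sigma> (d/dx - \<i>l0) + \<alpha>\<close>. Up to absorbing \<open>\<sigma>\<close> into \<open>A\<close>,
condition (1) says \<open>L T\<^sub>k = A T\<^sub>k\<^sub>+\<^sub>1\<close>. On the exponentials \<open>exp (\<i>\<xi>x)\<close> of type \<open>a\<close>, that is with
\<open>\<bar>Im \<xi>\<bar> \<le> a\<close>, the operator \<open>L\<close> acts as a number of modulus at least \<open>\<alpha>\<close>, with equality only for
\<open>\<xi> = l0\<close>. The theorem says that bounded orbits of \<open>L / A\<close> obey this spectral picture.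

The substitute for spectral theory is the semigroup \<open>exp (- t L)\<close>. On test functions it is an
explicit translation, twisted by an exponential and damped by \<open>exp (- \<alpha> t)\<close>; because \<open>l0\<close> lies on
the boundary of the strip, for \<open>t \<ge> 0\<close> the twist exactly compensates the exponential weight, and
every seminorm grows at most polynomially under it (\<open>weighted_drift_le\<close>). Expanding
\<open>T\<^sub>0 = exp (- t L) exp (t L) T\<^sub>0\<close> with \<open>L^k T\<^sub>0 = A^k T\<^sub>k\<close> gives, for every \<open>t \<ge> 0\<close>,
an expression of \<open>T\<^sub>0 f\<close> by the values of all \<open>T\<^sub>k\<close> at the translate of \<open>f\<close>
(\<open>drift_expansion\<close>). By condition (2) it is bounded by \<open>exp ((\<bar>A\<bar> - \<alpha>) t)\<close> times a power of \<open>1 + t\<close>.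

If \<open>\<bar>A\<bar> < \<alpha>\<close>, letting \<open>t\<close> tend to infinity gives \<open>T\<^sub>0 = 0\<close>, and likewise for all \<open>T\<^sub>k\<close>.

If \<open>\<bar>A\<bar> = \<alpha>\<close>, only polynomial growth of some order \<open>K\<close> is left. Each application of \<open>d/dx - \<i>l0\<close> to
\<open>T\<^sub>0\<close> improves the bound by a factor \<open>1 / sqrt t\<close>, by Cauchy's inequality on a disc of radius
\<open>sqrt t\<close> (\<open>iterated_difference_decay\<close>). Hence \<open>(d/dx - \<i>l0)^(2 K + 1) T\<^sub>k = 0\<close>, so \<open>T\<^sub>k\<close> is, up to
unimodular factors, polynomial in \<open>k\<close>; being bounded, it is constant, and the exponent can be lowered
to \<open>1\<close> (\<open>defect_descent\<close>).

If \<open>\<bar>A\<bar> > \<alpha>\<close>, there are two points \<open>\<xi> = l0 \<plusminus> s\<close> at which \<open>L\<close> acts with modulus \<open>\<bar>A\<bar>\<close>, and the sum of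
the two exponentials is the required counterexample (\<open>bounded_orbit_not_eigen\<close>).
\<close>

section \<open>Calculus in the space of test functions\<close>

lemma D_eqI: "(\<And>x. (f has_vector_derivative g x) (at x)) \<Longrightarrow> D f = g"
  unfolding D_def by (auto intro: vector_derivative_at)

lemma smooth_has_vector_derivative:
  assumes "smooth f"
  shows "((D ^^ n) f has_vector_derivative (D ^^ Suc n) f x) (at x)"
  using assms unfolding smooth_def by (simp add: D_def vector_derivative_works)

text \<open>Any sequence of functions in which each is the derivative of the one before identifies all
iterated derivatives of the first at once; this is how the iterated derivatives of sums,
translates and Gaussians are computed below.\<close>

lemma derivative_tower:
  assumes "\<And>n x. (F n has_vector_derivative F (Suc n) x) (at x)"
  shows "(D ^^ n) (F 0) = F n" and "smooth (F 0)"
proof -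
  show *: "(D ^^ n) (F 0) = F n" for n
    by (induction n) (simp_all add: D_eqI[OF assms])
  show "smooth (F 0)"
    unfolding smooth_def * using assms differentiableI_vector by blast
qed

lemma exp_schwartz_bounds:
  assumes "f \<in> exp_schwartz a"
  shows "smooth f" and "weighted a m n f x \<le> gam a m n f"
proof -
  show "smooth f" using assms by (simp add: exp_schwartz_def)
  have "bdd_above (range (weighted a m n f))" using assms by (simp add: exp_schwartz_def)
  then show "weighted a m n f x \<le> gam a m n f"
    unfolding gam_def by (rule cSUP_upper[OF UNIV_I])
qed

lemma weighted_nonneg: "0 \<le> weighted a m n f x"
  by (simp add: weighted_def)

lemma gam_nonneg: "f \<in> exp_schwartz a \<Longrightarrow> 0 \<le> gam a m n f"
  using exp_schwartz_bounds(2) weighted_nonneg order_trans by blast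

lemma gam_le: "(\<And>x. weighted a m n f x \<le> C) \<Longrightarrow> gam a m n f \<le> C"
  unfolding gam_def by (rule cSUP_least) auto

lemma exp_schwartzI:
  assumes "smooth f" and "\<And>m n x. weighted a m n f x \<le> C m n"
  shows "f \<in> exp_schwartz a"
  using assms unfolding exp_schwartz_def by (auto intro!: bdd_aboveI)

lemma iterated_D_linear:
  assumes "smooth f" "smooth g"
  shows "(D ^^ n) (\<lambda>x. b * f x + c * g x) = (\<lambda>x. b * (D ^^ n) f x + c * (D ^^ n) g x)"
    and "smooth (\<lambda>x. b * f x + c * g x)"
proof -
  let ?F = "\<lambda>n x. b * (D ^^ n) f x + c * (D ^^ n) g x"
  have "(?F n has_vector_derivative ?F (Suc n) x) (at x)" for n x
    by (intro has_vector_derivative_add has_vector_derivative_mult_right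
        smooth_has_vector_derivative assms)
  from derivative_tower[of ?F, OF this]
  show "(D ^^ n) (\<lambda>x. b * f x + c * g x) = ?F n" "smooth (\<lambda>x. b * f x + c * g x)" by simp_all
qed

lemma weighted_linear_le:
  assumes "smooth f" "smooth g"
  shows "weighted a m n (\<lambda>x. b * f x + c * g x) x
    \<le> cmod b * weighted a m n f x + cmod c * weighted a m n g x"
proof -
  have "cmod (b * (D ^^ n) f x + c * (D ^^ n) g x)
      \<le> cmod b * cmod ((D ^^ n) f x) + cmod c * cmod ((D ^^ n) g x)"
    by (metis norm_mult norm_triangle_ineq)
  then have "exp (a * \<bar>x\<bar>) * (1 + \<bar>x\<bar>) ^ m * cmod (b * (D ^^ n) f x + c * (D ^^ n) g x)
      \<le> exp (a * \<bar>x\<bar>) * (1 + \<bar>x\<bar>) ^ m * (cmod b * cmod ((D ^^ n) f x) + cmod c * cmod ((D ^^ n) g x))"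
    by (intro mult_left_mono) auto
  then show ?thesis
    unfolding weighted_def iterated_D_linear(1)[OF assms] by (simp add: algebra_simps)
qed

lemma exp_schwartz_linear:
  assumes "f \<in> exp_schwartz a" "g \<in> exp_schwartz a"
  shows "(\<lambda>x. b * f x + c * g x) \<in> exp_schwartz a"
    and "gam a m n (\<lambda>x. b * f x + c * g x) \<le> cmod b * gam a m n f + cmod c * gam a m n g"
proof -
  have le: "weighted a m n (\<lambda>x. b * f x + c * g x) x
      \<le> cmod b * gam a m n f + cmod c * gam a m n g" for m n x
    by (rule order_trans[OF weighted_linear_le])
       (use assms in \<open>auto intro!: add_mono mult_left_mono exp_schwartz_bounds\<close>)
  show "(\<lambda>x. b * f x + c * g x) \<in> exp_schwartz a"
    by (rule exp_schwartzI[OF iterated_D_linear(2)[OF assms[THEN exp_schwartz_bounds(1)]] le])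
  show "gam a m n (\<lambda>x. b * f x + c * g x) \<le> cmod b * gam a m n f + cmod c * gam a m n g"
    by (rule gam_le[OF le])
qed

lemma exp_schwartz_diff: "f \<in> exp_schwartz a \<Longrightarrow> g \<in> exp_schwartz a \<Longrightarrow> (\<lambda>x. f x - g x) \<in> exp_schwartz a"
  using exp_schwartz_linear(1)[of f a g 1 "-1"] by simp

lemma exp_schwartz_scale: "f \<in> exp_schwartz a \<Longrightarrow> (\<lambda>x. c * f x) \<in> exp_schwartz a"
  using exp_schwartz_linear(1)[of f a f c 0] by simp

lemma gam_add: "f \<in> exp_schwartz a \<Longrightarrow> g \<in> exp_schwartz a
    \<Longrightarrow> gam a m n (\<lambda>x. f x + g x) \<le> gam a m n f + gam a m n g"
  using exp_schwartz_linear(2)[of f a g m n 1 1] by simp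

lemma gam_minus_commute: "gam a m n (\<lambda>x. f x - g x) = gam a m n (\<lambda>x. g x - f x)"
  if "f \<in> exp_schwartz a" "g \<in> exp_schwartz a"
proof -
  have "gam a m n (\<lambda>x. f x - g x) \<le> gam a m n (\<lambda>x. g x - f x)"
    if "f \<in> exp_schwartz a" "g \<in> exp_schwartz a" for f g
    using exp_schwartz_linear(2)[OF exp_schwartz_diff[OF that(2,1)] exp_schwartz_diff[OF that(2,1)], of m n "-1" 0]
    by simp
  from this[OF that] this[OF that(2,1)] show ?thesis by simp
qed

lemma gam_scale:
  assumes "f \<in> exp_schwartz a"
  shows "gam a m n (\<lambda>x. c * f x) = cmod c * gam a m n f"
proof (rule antisym)
  have le: "gam a m n (\<lambda>x. c * f x) \<le> cmod c * gam a m n f" if "f \<in> exp_schwartz a" for c f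
    using exp_schwartz_linear(2)[OF that that, of m n c 0] by simp
  show "gam a m n (\<lambda>x. c * f x) \<le> cmod c * gam a m n f" by (rule le[OF assms])
  show "cmod c * gam a m n f \<le> gam a m n (\<lambda>x. c * f x)"
  proof (cases "c = 0")
    case True
    have "(\<lambda>x. c * f x) \<in> exp_schwartz a" by (rule exp_schwartz_scale[OF assms])
    with True show ?thesis using gam_nonneg by fastforce
  next
    case False
    with le[OF exp_schwartz_scale[OF assms, of c], of "inverse c"] show ?thesis
      by (simp add: field_simps norm_divide norm_inverse)
  qed
qed

lemma exp_schwartz_D: "D f \<in> exp_schwartz a" if "f \<in> exp_schwartz a"
proof (rule exp_schwartzI)
  have eq: "(D ^^ n) (D f) = (D ^^ Suc n) f" for n by (simp add: funpow_swap1)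
  show "smooth (D f)" using exp_schwartz_bounds(1)[OF that] unfolding smooth_def eq by blast
  show "weighted a m n (D f) x \<le> gam a m (Suc n) f" for m n x
    using exp_schwartz_bounds(2)[OF that, of m "Suc n" x] by (simp add: weighted_def eq del: funpow.simps)
qed

section \<open>The twisted translation semigroup\<close>

text \<open>Translation by \<open>t\<close>, twisted by an exponential. As an operator on test functions it is
\<open>exp (t (d/dx + \<i>l))\<close>, so for \<open>\<sigma> = sgn (Im l)\<close> the operators \<open>drift l (\<sigma> * t)\<close>, \<open>t \<ge> 0\<close>, form a
semigroup whose transpose is generated by \<open>-\<sigma> (d/dx - \<i>l)\<close>.\<close>

definition drift :: "complex \<Rightarrow> real \<Rightarrow> (real \<Rightarrow> complex) \<Rightarrow> real \<Rightarrow> complex" where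
  "drift l t f = (\<lambda>x. exp (\<i> * l * of_real t) * f (x + t))"

definition drift_gen :: "complex \<Rightarrow> (real \<Rightarrow> complex) \<Rightarrow> real \<Rightarrow> complex" where
  "drift_gen l f = (\<lambda>x. D f x + \<i> * l * f x)"

lemma drift_0 [simp]: "drift l 0 f = f"
  by (simp add: drift_def)

lemma drift_add: "drift l (s + t) f = drift l s (drift l t f)"
  by (rule ext) (simp add: drift_def exp_add[symmetric] algebra_simps)

lemma iterated_D_drift:
  assumes "smooth f"
  shows "(D ^^ n) (drift l t f) = drift l t ((D ^^ n) f)" and "smooth (drift l t f)"
proof -
  let ?F = "\<lambda>n. drift l t ((D ^^ n) f)"
  have "(?F n has_vector_derivative ?F (Suc n) x) (at x)" for n x
  proof -
    have "((\<lambda>x. x + t) has_vector_derivative 1) (at x)"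
      by (auto intro!: derivative_eq_intros)
    from vector_diff_chain_at[OF this smooth_has_vector_derivative[OF assms]]
    have "((\<lambda>x. (D ^^ n) f (x + t)) has_vector_derivative (D ^^ Suc n) f (x + t)) (at x)"
      by (simp add: o_def del: funpow.simps)
    then show ?thesis unfolding drift_def by (rule has_vector_derivative_mult_right)
  qed
  from derivative_tower[of ?F, OF this]
  show "(D ^^ n) (drift l t f) = ?F n" "smooth (drift l t f)" by simp_all
qed

lemma drift_gen_exp_schwartz: "drift_gen l f \<in> exp_schwartz a" if "f \<in> exp_schwartz a"
  unfolding drift_gen_def using exp_schwartz_linear(1)[OF exp_schwartz_D[OF that] that, of 1 "\<i> * l"] by simp

lemma iterated_D_drift_gen:
  assumes "smooth f"
  shows "(D ^^ n) (drift_gen l f) = drift_gen l ((D ^^ n) f)" and "smooth (drift_gen l f)"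
proof -
  have eq: "(D ^^ n) (D f) = (D ^^ Suc n) f" for n by (simp add: funpow_swap1)
  have sD: "smooth (D f)" using assms unfolding smooth_def eq by blast
  show "(D ^^ n) (drift_gen l f) = drift_gen l ((D ^^ n) f)"
    using iterated_D_linear(1)[OF sD assms, of n 1 "\<i> * l"] by (simp add: drift_gen_def eq)
  show "smooth (drift_gen l f)"
    using iterated_D_linear(2)[OF sD assms, of 1 "\<i> * l"] by (simp add: drift_gen_def)
qed

lemma drift_drift_gen:
  assumes "smooth f"
  shows "drift l t (drift_gen l f) = drift_gen l (drift l t f)"
  using iterated_D_drift(1)[OF assms, of 1 l t]
  by (simp add: drift_def drift_gen_def algebra_simps)

text \<open>The exponential factor is what makes the estimate useful: if \<open>t\<close> has the sign of \<open>Im l\<close> and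
\<open>a = \<bar>Im l\<bar>\<close>, the twist \<open>exp (- Im l * t)\<close> pays exactly for moving the weight \<open>exp (a * \<bar>x\<bar>)\<close> by \<open>t\<close>,
and only polynomial growth in \<open>t\<close> remains.\<close>

lemma weighted_drift_le:
  assumes "f \<in> exp_schwartz a" "0 \<le> a"
  shows "weighted a m n (drift l t f) x \<le> exp (a * \<bar>t\<bar> - Im l * t) * (1 + \<bar>t\<bar>) ^ m * gam a m n f"
proof -
  let ?y = "x + t"
  have ax: "a * \<bar>x\<bar> \<le> a * \<bar>?y\<bar> + a * \<bar>t\<bar>"
    using mult_left_mono[OF _ assms(2), of "\<bar>x\<bar>" "\<bar>?y\<bar> + \<bar>t\<bar>"] by (simp add: algebra_simps)
  have e: "exp (a * \<bar>x\<bar>) \<le> exp (a * \<bar>?y\<bar>) * exp (a * \<bar>t\<bar>)"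
    unfolding exp_add[symmetric] using ax by simp
  have "1 + \<bar>x\<bar> \<le> (1 + \<bar>?y\<bar>) * (1 + \<bar>t\<bar>)"
  proof -
    have "\<bar>x\<bar> \<le> \<bar>?y\<bar> + \<bar>t\<bar>" by simp
    moreover have "0 \<le> \<bar>?y\<bar> * \<bar>t\<bar>" by simp
    moreover have "(1 + \<bar>?y\<bar>) * (1 + \<bar>t\<bar>) = 1 + \<bar>?y\<bar> + \<bar>t\<bar> + \<bar>?y\<bar> * \<bar>t\<bar>"
      by (simp only: distrib_left distrib_right mult_1 mult_1_right add_ac)
    ultimately show ?thesis by linarith
  qed
  then have w: "(1 + \<bar>x\<bar>) ^ m \<le> (1 + \<bar>?y\<bar>) ^ m * (1 + \<bar>t\<bar>) ^ m"
    unfolding power_mult_distrib[symmetric] by (intro power_mono) auto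
  have "weighted a m n (drift l t f) x
      = exp (a * \<bar>x\<bar>) * (1 + \<bar>x\<bar>) ^ m * (exp (- (Im l * t)) * cmod ((D ^^ n) f ?y))"
    unfolding weighted_def iterated_D_drift(1)[OF exp_schwartz_bounds(1)[OF assms(1)]]
    by (simp add: drift_def norm_mult)
  also have "\<dots> \<le> (exp (a * \<bar>?y\<bar>) * exp (a * \<bar>t\<bar>)) * ((1 + \<bar>?y\<bar>) ^ m * (1 + \<bar>t\<bar>) ^ m)
      * (exp (- (Im l * t)) * cmod ((D ^^ n) f ?y))"
    by (intro mult_right_mono mult_mono e w) auto
  also have "\<dots> = exp (a * \<bar>t\<bar> - Im l * t) * (1 + \<bar>t\<bar>) ^ m * weighted a m n f ?y"
    unfolding weighted_def exp_diff by (simp add: exp_minus field_simps)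
  also have "\<dots> \<le> exp (a * \<bar>t\<bar> - Im l * t) * (1 + \<bar>t\<bar>) ^ m * gam a m n f"
    by (intro mult_left_mono exp_schwartz_bounds assms) auto
  finally show ?thesis .
qed

lemma drift_exp_schwartz:
  assumes "f \<in> exp_schwartz a" "0 \<le> a"
  shows "drift l t f \<in> exp_schwartz a"
    and "gam a m n (drift l t f) \<le> exp (a * \<bar>t\<bar> - Im l * t) * (1 + \<bar>t\<bar>) ^ m * gam a m n f"
  by (rule exp_schwartzI[OF _ weighted_drift_le[OF assms]] gam_le[OF weighted_drift_le[OF assms]]
      iterated_D_drift(2) exp_schwartz_bounds(1) assms)+

lemma drift_has_vector_derivative:
  assumes "smooth f"
  shows "((\<lambda>s. drift l s f x) has_vector_derivative drift l s (drift_gen l f) x) (at s)"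
proof -
  have "((\<lambda>s. x + s) has_vector_derivative 1) (at s)"
    by (auto intro!: derivative_eq_intros)
  from vector_diff_chain_at[OF this smooth_has_vector_derivative[OF assms, of 0]]
  have 1: "((\<lambda>s. f (x + s)) has_vector_derivative D f (x + s)) (at s)"
    by (simp add: o_def)
  have "((\<lambda>s. exp (\<i> * l * of_real s)) has_vector_derivative \<i> * l * exp (\<i> * l * of_real s)) (at s)"
    by (rule has_vector_derivative_real_field) (auto intro!: derivative_eq_intros)
  from has_vector_derivative_mult[OF this 1]
  show ?thesis by (simp add: drift_def drift_gen_def algebra_simps)
qed

lemma taylor_2:
  fixes v :: "real \<Rightarrow> complex"
  assumes v: "\<And>s. (v has_vector_derivative v' s) (at s)"
    and v': "\<And>s. (v' has_vector_derivative v'' s) (at s)"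
    and B: "\<And>s. \<bar>s\<bar> \<le> \<bar>h\<bar> \<Longrightarrow> cmod (v'' s) \<le> B"
  shows "cmod (v h - v 0 - of_real h * v' 0) \<le> B * h\<^sup>2"
proof -
  let ?S = "closed_segment 0 h"
  have S: "\<bar>s\<bar> \<le> \<bar>h\<bar>" if "s \<in> ?S" for s
    using that by (auto simp: closed_segment_eq_real_ivl split: if_splits)
  have 1: "cmod (v' s - v' 0) \<le> B * \<bar>h\<bar>" if "s \<in> ?S" for s
  proof -
    have "norm (v' s - v' 0) \<le> B * norm (s - 0)"
    proof (rule differentiable_bound[where S = ?S and f' = "\<lambda>s h. h *\<^sub>R v'' s"])
      show "onorm (\<lambda>h. h *\<^sub>R v'' x) \<le> B" if "x \<in> ?S" for x
        using B[OF S[OF that]] by (intro onorm_le) (simp add: mult.commute[of B] mult_left_mono)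
    qed (use that v' in \<open>auto simp: has_vector_derivative_def intro: has_derivative_at_withinI\<close>)
    also have "\<dots> \<le> B * \<bar>h\<bar>"
      using S[OF that] B[of 0] by (intro mult_left_mono) (auto intro: order_trans[OF norm_ge_zero])
    finally show ?thesis .
  qed
  have "norm (v h - v 0 - (h - 0) *\<^sub>R v' 0) \<le> norm (h - 0) * (B * \<bar>h\<bar>)"
    by (rule vector_differentiable_bound_linearization[where S = ?S])
       (use v 1 in \<open>auto intro: has_vector_derivative_at_within\<close>)
  then show ?thesis by (simp add: scaleR_conv_of_real power2_eq_square mult_ac abs_mult_self_eq)
qed

section \<open>Continuity in terms of the seminorms\<close>

lemma exp_schwartz_topspace [simp]: "topspace (exp_schwartz_topology a) = exp_schwartz a"
proof -
  have "f \<in> \<Union> {{g \<in> exp_schwartz a. gam a m n (\<lambda>x. g x - f x) < e} | f m n e.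
        f \<in> exp_schwartz a \<and> 0 < e}" if f: "f \<in> exp_schwartz a" for f
  proof -
    have "f \<in> {g \<in> exp_schwartz a. gam a 0 0 (\<lambda>x. g x - f x) < gam a 0 0 (\<lambda>x. f x - f x) + 1}"
      using f by simp
    moreover have "0 < gam a 0 0 (\<lambda>x. f x - f x) + 1"
      using gam_nonneg[OF exp_schwartz_diff[OF f f], of 0 0] by linarith
    ultimately show ?thesis using f by blast
  qed
  then show ?thesis unfolding exp_schwartz_topology_def by auto
qed

lemma open_gam_ball:
  assumes "f \<in> exp_schwartz a" "0 < e"
  shows "openin (exp_schwartz_topology a) {g \<in> exp_schwartz a. gam a m n (\<lambda>x. g x - f x) < e}"
  unfolding exp_schwartz_topology_def
  by (rule topology_generated_by_Basis) (use assms in blast)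

lemma gam_zero: "f \<in> exp_schwartz a \<Longrightarrow> gam a m n (\<lambda>x. f x - f x) = 0"
  using gam_scale[of f a m n 0] by simp

text \<open>Around every point the preimage of an open set contains a ball of the single seminorm
\<open>gam a m n\<close>, and such balls belong to the subbase.\<close>

lemma continuous_map_gam_bounded:
  fixes F :: "(real \<Rightarrow> complex) \<Rightarrow> 'b::metric_space"
  assumes "\<And>f g. f \<in> exp_schwartz a \<Longrightarrow> g \<in> exp_schwartz a
    \<Longrightarrow> dist (F g) (F f) \<le> C * gam a m n (\<lambda>x. g x - f x)"
  shows "continuous_map (exp_schwartz_topology a) euclidean F"
  unfolding continuous_map_def
proof (intro conjI allI impI)
  fix U :: "'b set" assume "openin euclidean U"
  then have U: "open U" by simp
  show "openin (exp_schwartz_topology a) {f \<in> topspace (exp_schwartz_topology a). F f \<in> U}"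
  proof (subst openin_subopen, intro ballI)
    fix f assume "f \<in> {f \<in> topspace (exp_schwartz_topology a). F f \<in> U}"
    then have f: "f \<in> exp_schwartz a" "F f \<in> U" by auto
    obtain e where e: "0 < e" "ball (F f) e \<subseteq> U" using U f(2) openE by blast
    define d where "d = e / (\<bar>C\<bar> + 1)"
    have d: "0 < d" using e by (simp add: d_def)
    let ?V = "{g \<in> exp_schwartz a. gam a m n (\<lambda>x. g x - f x) < d}"
    have "F g \<in> U" if g: "g \<in> ?V" for g
    proof -
      have "0 \<le> gam a m n (\<lambda>x. g x - f x)" using g f exp_schwartz_diff gam_nonneg by blast
      then have "C * gam a m n (\<lambda>x. g x - f x) \<le> (\<bar>C\<bar> + 1) * gam a m n (\<lambda>x. g x - f x)"
        by (intro mult_right_mono) auto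
      also have "\<dots> < (\<bar>C\<bar> + 1) * d" using g by (intro mult_strict_left_mono) auto
      also have "\<dots> = e" by (simp add: d_def add_nonneg_eq_0_iff)
      finally have "dist (F g) (F f) < e" using assms[of f g] g f by auto
      then show ?thesis using e by (auto simp: dist_commute)
    qed
    moreover have "f \<in> ?V" using f d gam_zero[OF f(1), of m n] by simp
    ultimately show "\<exists>T. openin (exp_schwartz_topology a) T \<and> f \<in> T
        \<and> T \<subseteq> {f \<in> topspace (exp_schwartz_topology a). F f \<in> U}"
      using open_gam_ball[OF f(1) d, of m n] by (intro exI[of _ ?V]) auto
  qed
qed auto

text \<open>These sums form a directed family, so their balls are a base of neighbourhoods, whereas the
balls of the single seminorms are only a subbase.\<close>

definition gam_sum :: "real \<Rightarrow> nat \<Rightarrow> (real \<Rightarrow> complex) \<Rightarrow> real" where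
  "gam_sum a K f = (\<Sum>m\<le>K. \<Sum>n\<le>K. gam a m n f)"

lemma gam_sum_nonneg: "f \<in> exp_schwartz a \<Longrightarrow> 0 \<le> gam_sum a K f"
  unfolding gam_sum_def by (intro sum_nonneg gam_nonneg)

lemma gam_sum_scale: "f \<in> exp_schwartz a \<Longrightarrow> gam_sum a K (\<lambda>x. c * f x) = cmod c * gam_sum a K f"
  unfolding gam_sum_def by (simp add: gam_scale sum_distrib_left)

lemma gam_le_gam_sum:
  assumes "f \<in> exp_schwartz a" "m \<le> K" "n \<le> K"
  shows "gam a m n f \<le> gam_sum a K f"
proof -
  have "gam a m n f \<le> (\<Sum>n\<le>K. gam a m n f)"
    by (rule member_le_sum) (use assms in \<open>auto intro: gam_nonneg\<close>)
  also have "\<dots> \<le> gam_sum a K f" unfolding gam_sum_def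
    by (rule member_le_sum[of m "{..K}" "\<lambda>m. \<Sum>n\<le>K. gam a m n f"])
       (use assms in \<open>auto intro!: gam_nonneg sum_nonneg\<close>)
  finally show ?thesis .
qed

lemma gam_sum_mono:
  assumes "f \<in> exp_schwartz a" "K \<le> L"
  shows "gam_sum a K f \<le> gam_sum a L f"
  unfolding gam_sum_def
  by (rule order_trans[OF sum_mono[OF sum_mono2] sum_mono2])
     (use assms in \<open>auto intro!: gam_nonneg sum_nonneg\<close>)

text \<open>Induction over the generation of the topology: a finite intersection is handled by passing to
the larger index, and a ball around another centre by the triangle inequality.\<close>

lemma exp_schwartz_nhd:
  assumes "openin (exp_schwartz_topology a) U" "f \<in> U"
  shows "\<exists>K e. 0 < e \<and> (\<forall>g\<in>exp_schwartz a. gam_sum a K (\<lambda>x. g x - f x) < e \<longrightarrow> g \<in> U)"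
proof -
  have "generate_topology_on {{g \<in> exp_schwartz a. gam a m n (\<lambda>x. g x - f x) < e} | f m n e.
        f \<in> exp_schwartz a \<and> 0 < e} U"
    using assms(1) unfolding exp_schwartz_topology_def by (rule openin_topology_generated_by)
  then show ?thesis using assms(2)
  proof (induction arbitrary: f)
    case Empty
    then show ?case by simp
  next
    case (Int S T)
    have f: "f \<in> exp_schwartz a"
    proof -
      have "openin (exp_schwartz_topology a) S"
        unfolding exp_schwartz_topology_def openin_topology_generated_by_iff by (rule Int.hyps(1))
      from openin_subset[OF this] Int.prems show ?thesis by auto
    qed
    obtain K e where 1: "0 < e" "\<And>g. g\<in>exp_schwartz a \<Longrightarrow> gam_sum a K (\<lambda>x. g x - f x) < e \<Longrightarrow> g \<in> S"
      using Int.IH(1) Int.prems by blast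
    obtain L d where 2: "0 < d" "\<And>g. g\<in>exp_schwartz a \<Longrightarrow> gam_sum a L (\<lambda>x. g x - f x) < d \<Longrightarrow> g \<in> T"
      using Int.IH(2) Int.prems by blast
    have "g \<in> S \<inter> T" if g: "g\<in>exp_schwartz a" "gam_sum a (max K L) (\<lambda>x. g x - f x) < min e d" for g
    proof -
      have "gam_sum a K (\<lambda>x. g x - f x) \<le> gam_sum a (max K L) (\<lambda>x. g x - f x)"
        "gam_sum a L (\<lambda>x. g x - f x) \<le> gam_sum a (max K L) (\<lambda>x. g x - f x)"
        by (auto intro!: gam_sum_mono exp_schwartz_diff g f)
      with g show ?thesis by (auto intro!: 1 2)
    qed
    with 1(1) 2(1) show ?case by (intro exI[of _ "max K L"] exI[of _ "min e d"]) auto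
  next
    case (UN \<U>)
    then obtain V where V: "V \<in> \<U>" "f \<in> V" by blast
    from UN.IH[OF V] V(1) show ?case by blast
  next
    case (Basis s)
    then obtain h m n e where s: "s = {g \<in> exp_schwartz a. gam a m n (\<lambda>x. g x - h x) < e}"
      and h: "h \<in> exp_schwartz a" by blast
    have f: "f \<in> exp_schwartz a" "gam a m n (\<lambda>x. f x - h x) < e" using Basis.prems s by auto
    have "g \<in> s" if g: "g\<in>exp_schwartz a"
      "gam_sum a (max m n) (\<lambda>x. g x - f x) < e - gam a m n (\<lambda>x. f x - h x)" for g
    proof -
      have "gam a m n (\<lambda>x. g x - h x) \<le> gam a m n (\<lambda>x. g x - f x) + gam a m n (\<lambda>x. f x - h x)"
        using gam_add[OF exp_schwartz_diff[OF g(1) f(1)] exp_schwartz_diff[OF f(1) h], of m n] by simp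
      moreover have "gam a m n (\<lambda>x. g x - f x) \<le> gam_sum a (max m n) (\<lambda>x. g x - f x)"
        by (intro gam_le_gam_sum exp_schwartz_diff g f) auto
      ultimately show ?thesis using g s by simp
    qed
    then show ?case using f(2)
      by (intro exI[of _ "max m n"] exI[of _ "e - gam a m n (\<lambda>x. f x - h x)"]) auto
  qed
qed

text \<open>The usual homogeneity argument: the unit ball of \<open>p\<close> contains a ball of some \<open>gam_sum a K\<close>
around the origin, and scaling turns this inclusion into an inequality.\<close>

lemma continuous_seminorm_le_gam_sum:
  assumes "continuous_seminorm a p"
  obtains K C where "0 < C" "\<And>f. f \<in> exp_schwartz a \<Longrightarrow> p f \<le> C * gam_sum a K f"
proof -
  define z :: "real \<Rightarrow> complex" where "z = (\<lambda>x. 0)"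
  have hom: "\<And>c f. f \<in> exp_schwartz a \<Longrightarrow> p (\<lambda>x. c * f x) = cmod c * p f"
    and cont: "continuous_map (exp_schwartz_topology a) euclideanreal p"
    using assms unfolding continuous_seminorm_def by auto
  show ?thesis
  proof (cases "exp_schwartz a = {}")
    case True
    then show ?thesis using that[of 1 0] by auto
  next
    case False
    then obtain f0 where f0: "f0 \<in> exp_schwartz a" by blast
    have z: "z \<in> exp_schwartz a" using exp_schwartz_scale[OF f0, of 0] by (simp add: z_def)
    have pz: "p z = 0" using hom[OF f0, of 0] by (simp add: z_def)
    let ?U = "{f \<in> topspace (exp_schwartz_topology a). p f \<in> {..<1}}"
    have U: "openin (exp_schwartz_topology a) ?U"
      by (rule openin_continuous_map_preimage[OF cont]) auto
    have "z \<in> ?U" using z pz by simp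
    from exp_schwartz_nhd[OF U this] obtain K e where e: "0 < e"
      and nhd: "\<And>g. g\<in>exp_schwartz a \<Longrightarrow> gam_sum a K (\<lambda>x. g x - z x) < e \<Longrightarrow> g \<in> ?U" by blast
    have *: "p f \<le> 1 / e * gam_sum a K f" if f: "f \<in> exp_schwartz a" for f
    proof (rule ccontr)
      assume neg: "\<not> ?thesis"
      define c where "c = p f"
      have q: "0 \<le> gam_sum a K f" by (rule gam_sum_nonneg[OF f])
      have c: "1 / e * gam_sum a K f < c" using neg by (simp add: c_def)
      moreover have "0 \<le> 1 / e * gam_sum a K f" using q e by simp
      ultimately have c0: "0 < c" by linarith
      define g where "g = (\<lambda>x. of_real (1 / c) * f x)"
      have g: "g \<in> exp_schwartz a" unfolding g_def by (rule exp_schwartz_scale[OF f])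
      have "gam_sum a K g = gam_sum a K f / c"
        unfolding g_def gam_sum_scale[OF f] using c0 by (simp add: norm_divide)
      also have "\<dots> < e" using c c0 e q by (simp add: field_simps)
      finally have "gam_sum a K (\<lambda>x. g x - z x) < e" by (simp add: z_def)
      from nhd[OF g this] have "p g < 1" by simp
      moreover have "p g = 1" unfolding g_def hom[OF f] using c0 by (simp add: c_def norm_divide)
      ultimately show False by simp
    qed
    show ?thesis by (rule that[of "1 / e" K]) (use * e in auto)
  qed
qed

lemma gam_sum_drift_le:
  assumes "f \<in> exp_schwartz a" "0 \<le> a"
  shows "gam_sum a K (drift l t f) \<le> exp (a * \<bar>t\<bar> - Im l * t) * (1 + \<bar>t\<bar>) ^ K * gam_sum a K f"
proof -
  have "gam a m n (drift l t f) \<le> exp (a * \<bar>t\<bar> - Im l * t) * (1 + \<bar>t\<bar>) ^ K * gam a m n f"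
    if "m \<le> K" for m n
    by (rule order_trans[OF drift_exp_schwartz(2)[OF assms]])
       (intro mult_right_mono mult_left_mono power_increasing that gam_nonneg assms; simp)
  then show ?thesis unfolding gam_sum_def sum_distrib_left by (intro sum_mono) auto
qed

text \<open>A second order Taylor estimate at each \<open>x\<close>, made uniform in \<open>x\<close> because the second derivative
of \<open>t \<mapsto> drift l t f x\<close> is again a drifted test function. It says that the difference quotients of
the drift converge in every seminorm, so that continuous functionals may be differentiated
along it.\<close>

lemma gam_drift_taylor:
  assumes f: "f \<in> exp_schwartz a" and a: "0 \<le> a" and h: "\<bar>h\<bar> \<le> 1"
  shows "gam a m n (\<lambda>x. drift l h f x - f x - of_real h * drift_gen l f x)
    \<le> exp (a + \<bar>Im l\<bar>) * 2 ^ m * gam a m n (drift_gen l (drift_gen l f)) * h\<^sup>2"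
proof (rule gam_le)
  fix x
  let ?w = "exp (a * \<bar>x\<bar>) * (1 + \<bar>x\<bar>) ^ m"
  let ?g = "(D ^^ n) f" and ?W = "drift_gen l"
  define B where "B = exp (a + \<bar>Im l\<bar>) * 2 ^ m * gam a m n (?W (?W f))"
  note sm = exp_schwartz_bounds(1)
  have Wf: "?W f \<in> exp_schwartz a" and WWf: "?W (?W f) \<in> exp_schwartz a"
    by (intro drift_gen_exp_schwartz f)+
  have sg: "smooth ?g" 
    using sm[OF f] unfolding smooth_def comp_apply[of "D ^^ _" "D ^^ n" f, symmetric] funpow_add[symmetric] by blast
  have sW: "smooth (?W ?g)" by (rule iterated_D_drift_gen[OF sg])
  have w: "0 < ?w" by (simp add: add_pos_nonneg)
  have B: "cmod (drift l s (?W (?W ?g)) x) \<le> B / ?w" if s: "\<bar>s\<bar> \<le> \<bar>h\<bar>" for s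
  proof -
    have "drift l s (?W (?W ?g)) = (D ^^ n) (drift l s (?W (?W f)))"
      by (simp add: iterated_D_drift(1)[OF sm[OF WWf]] iterated_D_drift_gen(1)[OF sm[OF Wf]]
          iterated_D_drift_gen(1)[OF sm[OF f]])
    then have "?w * cmod (drift l s (?W (?W ?g)) x) = weighted a m n (drift l s (?W (?W f))) x"
      by (simp add: weighted_def)
    also have "\<dots> \<le> exp (a * \<bar>s\<bar> - Im l * s) * (1 + \<bar>s\<bar>) ^ m * gam a m n (?W (?W f))"
      by (rule weighted_drift_le[OF WWf a])
    also have "\<dots> \<le> B" unfolding B_def
    proof (intro mult_right_mono mult_mono)
      have "a * \<bar>s\<bar> \<le> a * 1" using s h a by (intro mult_left_mono) auto
      moreover have "- (Im l * s) \<le> \<bar>Im l\<bar> * 1"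
        using mult_left_mono[of "\<bar>s\<bar>" 1 "\<bar>Im l\<bar>"] s h abs_ge_minus_self[of "Im l * s"]
        by (simp add: abs_mult)
      ultimately show "exp (a * \<bar>s\<bar> - Im l * s) \<le> exp (a + \<bar>Im l\<bar>)" by simp
      show "(1 + \<bar>s\<bar>) ^ m \<le> 2 ^ m" using s h by (intro power_mono) auto
    qed (auto intro: gam_nonneg[OF WWf])
    finally show ?thesis using w by (simp add: pos_le_divide_eq mult.commute)
  qed
  have "cmod (drift l h ?g x - drift l 0 ?g x - of_real h * drift l 0 (?W ?g) x) \<le> B / ?w * h\<^sup>2"
    by (rule taylor_2[OF drift_has_vector_derivative[OF sg] drift_has_vector_derivative[OF sW] B])
  then have *: "?w * cmod (drift l h ?g x - ?g x - of_real h * ?W ?g x) \<le> B * h\<^sup>2"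
    using w by (simp add: field_simps)
  have "(D ^^ n) (\<lambda>x. drift l h f x - f x - of_real h * ?W f x) x
      = drift l h ?g x - ?g x - of_real h * ?W ?g x"
  proof -
    have s1: "smooth (drift l h f)" by (rule iterated_D_drift(2)[OF sm[OF f]])
    have s2: "smooth (\<lambda>x. drift l h f x - f x)"
      using iterated_D_linear(2)[OF s1 sm[OF f], of 1 "-1"] by simp
    have "(D ^^ n) (\<lambda>x. drift l h f x - f x) = (\<lambda>x. drift l h ?g x - ?g x)"
      using iterated_D_linear(1)[OF s1 sm[OF f], of n 1 "-1"]
      by (simp add: iterated_D_drift(1)[OF sm[OF f]])
    with iterated_D_linear(1)[OF s2 sm[OF Wf], of n 1 "- of_real h"] show ?thesis
      by (simp add: iterated_D_drift_gen(1)[OF sm[OF f]])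
  qed
  with * show "weighted a m n (\<lambda>x. drift l h f x - f x - of_real h * ?W f x) x
      \<le> exp (a + \<bar>Im l\<bar>) * 2 ^ m * gam a m n (?W (?W f)) * h\<^sup>2"
    by (simp add: weighted_def B_def)
qed

lemma has_vector_derivative_quadratic:
  fixes F :: "real \<Rightarrow> 'b::real_normed_vector"
  assumes "\<And>h. \<bar>h\<bar> \<le> 1 \<Longrightarrow> norm (F (t + h) - F t - h *\<^sub>R L) \<le> C * h\<^sup>2"
  shows "(F has_vector_derivative L) (at t)"
  unfolding has_vector_derivative_def has_derivative_at
proof (intro conjI bounded_linear_scaleR_left)
  show "(\<lambda>h. norm (F (t + h) - F t - h *\<^sub>R L) / norm h) \<midarrow>0\<rightarrow> 0"
  proof (rule Lim_null_comparison)
    show "\<forall>\<^sub>F h in at 0. norm (norm (F (t + h) - F t - h *\<^sub>R L) / norm h) \<le> C * \<bar>h\<bar>"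
      unfolding eventually_at
    proof (intro exI[of _ 1] conjI ballI impI)
      fix h :: real assume "h \<noteq> 0 \<and> dist h 0 < 1"
      then have "h \<noteq> 0" "\<bar>h\<bar> \<le> 1" by auto
      then show "norm (norm (F (t + h) - F t - h *\<^sub>R L) / norm h) \<le> C * \<bar>h\<bar>"
        using assms[of h] by (simp add: divide_le_eq power2_eq_square mult.assoc)
    qed simp
    show "(\<lambda>h. C * \<bar>h\<bar>) \<midarrow>0\<rightarrow> 0" by (auto intro!: tendsto_eq_intros)
  qed
qed

lemma functional_drift_derivative:
  fixes T :: functional
  assumes lin: "\<And>f g. f \<in> exp_schwartz a \<Longrightarrow> g \<in> exp_schwartz a \<Longrightarrow> T (\<lambda>x. f x + g x) = T f + T g"
    and hom: "\<And>c f. f \<in> exp_schwartz a \<Longrightarrow> T (\<lambda>x. c * f x) = c * T f"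
    and bnd: "\<And>f. f \<in> exp_schwartz a \<Longrightarrow> cmod (T f) \<le> C * gam_sum a K f"
    and C: "0 \<le> C" and a: "0 \<le> a" and f: "f \<in> exp_schwartz a"
  shows "((\<lambda>t. T (drift l t f)) has_vector_derivative T (drift l t (drift_gen l f))) (at t)"
proof -
  let ?g = "drift l t f" and ?W = "drift_gen l"
  have g: "?g \<in> exp_schwartz a" by (rule drift_exp_schwartz[OF f a])
  define R where "R = C * (\<Sum>m\<le>K. \<Sum>n\<le>K. exp (a + \<bar>Im l\<bar>) * 2 ^ m * gam a m n (?W (?W ?g)))"
  have "cmod (T (drift l (t + h) f) - T ?g - h *\<^sub>R T (?W ?g)) \<le> R * h\<^sup>2" if h: "\<bar>h\<bar> \<le> 1" for h
  proof -
    let ?r = "\<lambda>x. drift l h ?g x - ?g x - of_real h * ?W ?g x"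
    have hg: "drift l h ?g \<in> exp_schwartz a" by (rule drift_exp_schwartz[OF g a])
    have Wg: "?W ?g \<in> exp_schwartz a" by (rule drift_gen_exp_schwartz[OF g])
    have "T (\<lambda>x. drift l h ?g x - ?g x) = T (drift l h ?g) - T ?g"
      using lin[OF hg exp_schwartz_scale[OF g, of "-1"]] hom[OF g, of "-1"] by simp
    moreover have "T ?r = T (\<lambda>x. drift l h ?g x - ?g x) - of_real h * T (?W ?g)"
      using lin[OF exp_schwartz_diff[OF hg g] exp_schwartz_scale[OF Wg, of "- of_real h"]]
        hom[OF Wg, of "- of_real h"] by simp
    ultimately have "cmod (T (drift l (t + h) f) - T ?g - h *\<^sub>R T (?W ?g)) = cmod (T ?r)"
      by (simp add: drift_add[symmetric] add.commute scaleR_conv_of_real)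
    also have "\<dots> \<le> C * gam_sum a K ?r"
      by (intro bnd exp_schwartz_diff exp_schwartz_scale hg g Wg)
    also have "\<dots> \<le> C * (\<Sum>m\<le>K. \<Sum>n\<le>K. exp (a + \<bar>Im l\<bar>) * 2 ^ m * gam a m n (?W (?W ?g)) * h\<^sup>2)"
      unfolding gam_sum_def by (intro mult_left_mono sum_mono gam_drift_taylor g a h C)
    also have "\<dots> = R * h\<^sup>2" by (simp add: R_def sum_distrib_right mult.assoc)
    finally show ?thesis .
  qed
  from has_vector_derivative_quadratic[OF this] show ?thesis
    by (simp add: drift_drift_gen[OF exp_schwartz_bounds(1)[OF f]])
qed

section \<open>Exponential series of bounded sequences\<close>

lemma exponential_series:
  fixes b :: "nat \<Rightarrow> complex"
  assumes "\<And>k. cmod (b k) \<le> K"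
  shows "summable (\<lambda>k. z ^ k / fact k * b k)"
    and "cmod (\<Sum>k. z ^ k / fact k * b k) \<le> exp (cmod z) * K"
proof -
  have "(\<lambda>k. cmod z ^ k /\<^sub>R fact k) sums exp (cmod z)" by (rule exp_converges)
  from sums_mult2[OF this, of K]
  have g: "(\<lambda>k. cmod z ^ k / fact k * K) sums (exp (cmod z) * K)" by (simp add: field_simps)
  have le: "cmod (z ^ k / fact k * b k) \<le> cmod z ^ k / fact k * K" for k
    unfolding norm_mult norm_divide norm_power by (simp add: assms mult_left_mono divide_right_mono)
  show "summable (\<lambda>k. z ^ k / fact k * b k)"
    by (rule summable_comparison_test'[OF sums_summable[OF g]]) (use le in auto)
  show "cmod (\<Sum>k. z ^ k / fact k * b k) \<le> exp (cmod z) * K"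
    using norm_suminf_le[OF le sums_summable[OF g]]
    by (simp add: sums_unique[OF g])
qed

text \<open>Since \<open>c k\<close> has the derivative \<open>- A * c (Suc k)\<close>, the series is the Taylor expansion
of \<open>c 0\<close> about \<open>t\<close>, evaluated at \<open>0\<close>. The bound on the \<open>c k\<close> is uniform in \<open>k\<close>, so the remainder is
dominated by a term of an exponential series.\<close>

lemma backward_taylor_series:
  fixes c :: "nat \<Rightarrow> real \<Rightarrow> complex"
  assumes der: "\<And>k s. 0 \<le> s \<Longrightarrow> s \<le> t \<Longrightarrow> (c k has_vector_derivative - A * c (Suc k) s) (at s)"
    and bnd: "\<And>k s. 0 \<le> s \<Longrightarrow> s \<le> t \<Longrightarrow> cmod (c k s) \<le> K"
    and t: "0 \<le> t"
  shows "(\<lambda>k. (A * of_real t) ^ k / fact k * c k t) sums c 0 0"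
proof -
  define H where "H n s = (\<Sum>k\<le>n. (A * of_real s) ^ k / fact k * c k s)" for n s
  have H0: "H n 0 = c 0 0" for n
    unfolding H_def by (induction n) auto
  have pw: "((\<lambda>s. (A * of_real s) ^ Suc n / fact (Suc n)) has_vector_derivative
      A * (A * of_real s) ^ n / fact n) (at s)" for n and s :: real
  proof (rule has_vector_derivative_real_field)
    show "((\<lambda>z. (A * z) ^ Suc n / fact (Suc n)) has_field_derivative
        A * (A * of_real s) ^ n / fact n) (at (of_real s))"
      by (rule derivative_eq_intros refl | simp add: divide_simps del: of_nat_Suc power_Suc)+
  qed
  \<comment> \<open>The derivative of the partial sum telescopes: only the last term survives.\<close>
  have dH: "(H n has_vector_derivative - (A * (A * of_real s) ^ n / fact n * c (Suc n) s)) (at s)"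
    if s: "0 \<le> s" "s \<le> t" for n s
  proof (induction n)
    case 0
    show ?case using der[OF s, of 0] by (simp add: H_def[abs_def])
  next
    case (Suc n)
    have eq: "H (Suc n) = (\<lambda>s. H n s + (A * of_real s) ^ Suc n / fact (Suc n) * c (Suc n) s)"
      by (simp add: H_def fun_eq_iff)
    have "(H (Suc n) has_vector_derivative
        - (A * (A * of_real s) ^ n / fact n * c (Suc n) s)
        + ((A * of_real s) ^ Suc n / fact (Suc n) * (- A * c (Suc (Suc n)) s)
           + A * (A * of_real s) ^ n / fact n * c (Suc n) s)) (at s)"
      unfolding eq by (intro has_vector_derivative_add Suc has_vector_derivative_mult pw der s)
    then show ?case by (simp add: mult_ac del: power_Suc fact_Suc)
  qed
  have bound: "cmod (H n t - c 0 0) \<le> (cmod A * K * t) * (inverse (fact n) * (cmod A * t) ^ n)" for n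
  proof -
    have "norm (H n t - H n 0) \<le> cmod A * (cmod A * t) ^ n / fact n * K * norm (t - 0)"
    proof (rule differentiable_bound[where S = "{0..t}"
          and f' = "\<lambda>s h. h *\<^sub>R - (A * (A * of_real s) ^ n / fact n * c (Suc n) s)"])
      fix s assume s: "s \<in> {0..t}"
      show "(H n has_derivative (\<lambda>h. h *\<^sub>R - (A * (A * of_real s) ^ n / fact n * c (Suc n) s))) (at s within {0..t})"
        using dH[of s n] s has_derivative_at_withinI by (fastforce simp: has_vector_derivative_def)
      have "cmod (A * (A * of_real s) ^ n / fact n * c (Suc n) s) \<le> cmod A * (cmod A * t) ^ n / fact n * K"
        unfolding norm_mult norm_divide norm_power norm_fact
        by (intro mult_mono divide_right_mono power_mono bnd) (use s in auto)
      then show "onorm (\<lambda>h. h *\<^sub>R - (A * (A * of_real s) ^ n / fact n * c (Suc n) s))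
          \<le> cmod A * (cmod A * t) ^ n / fact n * K"
        by (intro onorm_le)
          (simp only: norm_scaleR norm_minus_cancel real_norm_def mult.commute[of _ "\<bar>_\<bar>"] mult_left_mono abs_ge_zero)
    qed (use t in auto)
    then show ?thesis using t by (simp add: H0 field_simps)
  qed
  have "(\<lambda>n. H n t - c 0 0) \<longlonglongrightarrow> 0"
  proof (rule Lim_null_comparison[OF always_eventually[OF allI[OF bound]]])
    show "(\<lambda>n. (cmod A * K * t) * (inverse (fact n) * (cmod A * t) ^ n)) \<longlonglongrightarrow> 0"
      by (rule tendsto_mult_right_zero[OF summable_LIMSEQ_zero[OF summable_exp]])
  qed
  then have "(\<lambda>n. H n t) \<longlonglongrightarrow> c 0 0" by (simp add: LIM_zero_iff)
  then show ?thesis unfolding H_def sums_def_le .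
qed

text \<open>The quantity estimated is the \<open>N\<close>-th derivative at \<open>t\<close> of the entire function
\<open>G 0 z = exp (- \<alpha> z) * (\<Sum>k. (A z)^k / k! * e 0 k)\<close>, whose modulus is at most
\<open>K * exp (\<alpha> (\<bar>z\<bar> - Re z))\<close>. Near the positive real axis \<open>\<bar>z\<bar> - Re z\<close> is about \<open>(Im z)^2 / (2 Re z)\<close>, which
stays bounded on the disc around \<open>t\<close> of radius \<open>sqrt t\<close>; Cauchy's inequality on this disc gains
one factor \<open>sqrt t\<close> for each derivative. In probabilistic terms, differences of Poisson weights
of mean \<open>\<alpha> t\<close> lose a factor \<open>sqrt t\<close> each.\<close>

lemma iterated_difference_decay:
  fixes e :: "nat \<Rightarrow> nat \<Rightarrow> complex" and A :: complex and \<alpha> t :: real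
  assumes e: "\<And>j k. e (Suc j) k = A * e j (Suc k) - of_real \<alpha> * e j k"
    and K: "\<And>k. cmod (e 0 k) \<le> K" and A: "cmod A = \<alpha>" and t: "4 \<le> t"
  shows "cmod (exp (- of_real (\<alpha> * t)) * (\<Sum>k. (A * of_real t) ^ k / fact k * e N k))
    \<le> fact N * (K * exp \<alpha>) / sqrt t ^ N"
proof -
  have \<alpha>: "0 \<le> \<alpha>" using A by auto
  have K0: "0 \<le> K" using K[of 0] norm_ge_zero order_trans by blast
  have ej: "cmod (e j k) \<le> (2 * \<alpha>) ^ j * K" for j k
  proof (induction j arbitrary: k)
    case 0
    show ?case using K by simp
  next
    case (Suc j)
    have "cmod (e (Suc j) k) \<le> \<alpha> * cmod (e j (Suc k)) + \<alpha> * cmod (e j k)"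
      unfolding e using norm_triangle_ineq4[of "A * e j (Suc k)" "of_real \<alpha> * e j k"] A \<alpha>
      by (simp add: norm_mult)
    also have "\<dots> \<le> \<alpha> * ((2 * \<alpha>) ^ j * K) + \<alpha> * ((2 * \<alpha>) ^ j * K)"
      by (intro add_mono mult_left_mono Suc \<alpha>)
    also have "\<dots> = (2 * \<alpha>) ^ Suc j * K" by (simp add: algebra_simps)
    finally show ?case .
  qed
  define E where "E j z = (\<Sum>k. (A * z) ^ k / fact k * e j k)" for j z
  define G where "G j z = exp (- (of_real \<alpha> * z)) * E j z" for j z
  have sumE: "summable (\<lambda>k. (A * z) ^ k / fact k * e j k)" for j z
    by (rule exponential_series(1)[OF ej])
  have dE: "(E j has_field_derivative (\<Sum>k. A * ((A * z) ^ k / fact k * e j (Suc k)))) (at z)" for j z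
  proof -
    define cf where "cf k = A ^ k / fact k * e j k" for k
    have "summable (\<lambda>k. cf k * y ^ k)" for y
      using sumE[of y j] by (simp add: cf_def power_mult_distrib mult_ac)
    from termdiffs_strong_converges_everywhere[OF this, of z]
    have "((\<lambda>z. \<Sum>k. cf k * z ^ k) has_field_derivative (\<Sum>k. diffs cf k * z ^ k)) (at z)" .
    moreover have "(\<lambda>z. \<Sum>k. cf k * z ^ k) = E j"
      by (simp add: E_def cf_def power_mult_distrib mult_ac fun_eq_iff)
    moreover have "diffs cf k * z ^ k = A * ((A * z) ^ k / fact k * e j (Suc k))" for k
      by (simp add: diffs_def cf_def power_mult_distrib field_simps del: of_nat_Suc)
    ultimately show ?thesis by simp
  qed
  have dG: "(G j has_field_derivative G (Suc j) z) (at z)" for j z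
  proof -
    have s1: "summable (\<lambda>k. (A * z) ^ k / fact k * e j (Suc k))"
      by (rule exponential_series(1)[OF ej])
    have "E (Suc j) z = (\<Sum>k. A * ((A * z) ^ k / fact k * e j (Suc k))
        - of_real \<alpha> * ((A * z) ^ k / fact k * e j k))"
      unfolding E_def e by (simp add: algebra_simps)
    also have "\<dots> = (\<Sum>k. A * ((A * z) ^ k / fact k * e j (Suc k))) - of_real \<alpha> * E j z"
      unfolding E_def suminf_mult[OF sumE, symmetric]
      by (rule suminf_diff[symmetric]) (rule summable_mult s1 sumE)+
    finally have "(\<Sum>k. A * ((A * z) ^ k / fact k * e j (Suc k))) = E (Suc j) z + of_real \<alpha> * E j z"
      by simp
    with dE[of j z] have "(E j has_field_derivative E (Suc j) z + of_real \<alpha> * E j z) (at z)" by simp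
    then show ?thesis unfolding G_def
      by (auto intro!: derivative_eq_intros simp: algebra_simps)
  qed
  have derivG: "(deriv ^^ j) (G 0) = G j" for j
    by (induction j) (auto intro!: DERIV_imp_deriv dG)
  have "cmod ((deriv ^^ N) (G 0) (of_real t)) \<le> fact N * (K * exp \<alpha>) / sqrt t ^ N"
  proof (rule Cauchy_inequality)
    have "G 0 holomorphic_on UNIV"
      unfolding holomorphic_on_def field_differentiable_def using dG by blast
    then show "G 0 holomorphic_on ball (of_real t) (sqrt t)" "continuous_on (cball (of_real t) (sqrt t)) (G 0)"
      by (auto intro: holomorphic_on_subset holomorphic_on_imp_continuous_on continuous_on_subset)
    show "0 < sqrt t" using t by simp
    fix z assume z: "norm (complex_of_real t - z) = sqrt t"
    \<comment> \<open>This is where \<open>4 \<le> t\<close> enters: the disc stays in \<open>Re z \<ge> t / 2\<close>.\<close>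
    have r: "sqrt t \<le> t / 2"
    proof (rule real_le_lsqrt)
      have "4 * t \<le> t * t" using t by (intro mult_right_mono) auto
      then show "t \<le> (t / 2)\<^sup>2" by (simp add: power2_eq_square)
    qed (use t in auto)
    have re: "t / 2 \<le> Re z"
      using abs_Re_le_cmod[of "complex_of_real t - z"] z r by simp
    have "\<bar>Im z\<bar> \<le> sqrt t"
      using abs_Im_le_cmod[of "complex_of_real t - z"] z by simp
    then have im: "(Im z)\<^sup>2 \<le> t" using t by (metis abs_le_square_iff abs_of_nonneg real_sqrt_ge_0_iff real_sqrt_pow2 order_trans zero_le_numeral)
    have "cmod z \<le> Re z + 1"
      unfolding cmod_def
    proof (rule real_le_lsqrt)
      show "(Re z)\<^sup>2 + (Im z)\<^sup>2 \<le> (Re z + 1)\<^sup>2"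
        using im re by (simp add: power2_eq_square algebra_simps)
    qed (use re t in auto)
    then have "\<alpha> * cmod z \<le> \<alpha> * (Re z + 1)" by (intro mult_left_mono \<alpha>)
    then have "- (\<alpha> * Re z) + \<alpha> * cmod z \<le> \<alpha>" by (simp add: algebra_simps)
    then have ee: "exp (- (\<alpha> * Re z)) * exp (\<alpha> * cmod z) \<le> exp \<alpha>"
      unfolding exp_add[symmetric] by simp
    have "cmod (G 0 z) = exp (- (\<alpha> * Re z)) * cmod (E 0 z)"
      by (simp add: G_def norm_mult)
    also have "\<dots> \<le> exp (- (\<alpha> * Re z)) * (exp (cmod (A * z)) * K)"
      unfolding E_def by (intro mult_left_mono exponential_series K) auto
    also have "\<dots> = (exp (- (\<alpha> * Re z)) * exp (\<alpha> * cmod z)) * K"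
      by (simp add: norm_mult A)
    also have "\<dots> \<le> exp \<alpha> * K" by (intro mult_right_mono ee K0)
    finally show "norm (G 0 z) \<le> K * exp \<alpha>" by (simp add: mult.commute)
  qed
  then show ?thesis unfolding derivG G_def E_def by simp
qed

section \<open>Bounded forward orbits\<close>

text \<open>A one-sided sequence satisfying conditions (1) and (2), with both signs of \<open>Im l\<close> treated at
once. After multiplication by \<open>\<sigma> = sgn (Im l)\<close> the recurrence reads
\<open>(\<sigma> (d/dx - \<i>l) + \<alpha>) T\<^sub>k = A T\<^sub>k\<^sub>+\<^sub>1\<close>, where \<open>A\<close> has absorbed the sign, and assumption
\<open>step\<close> is this equation moved to the test function. A doubly infinite sequence gives one such orbit
for each starting index.\<close>

locale damped_orbit =
  fixes a \<alpha> \<sigma> :: real and l A :: complex and T :: "nat \<Rightarrow> functional" and C :: real and K :: nat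
  assumes a: "0 \<le> a" and \<sigma>: "\<bar>\<sigma>\<bar> = 1" and im: "\<sigma> * Im l = a" and C: "0 \<le> C"
    and add: "\<And>k f g. f \<in> exp_schwartz a \<Longrightarrow> g \<in> exp_schwartz a \<Longrightarrow> T k (\<lambda>x. f x + g x) = T k f + T k g"
    and scale: "\<And>k c f. f \<in> exp_schwartz a \<Longrightarrow> T k (\<lambda>x. c * f x) = c * T k f"
    and bound: "\<And>k f. f \<in> exp_schwartz a \<Longrightarrow> cmod (T k f) \<le> C * gam_sum a K f"
    and step: "\<And>k f. f \<in> exp_schwartz a \<Longrightarrow>
      of_real \<sigma> * T k (drift_gen l f) = of_real \<alpha> * T k f - A * T (Suc k) f"
begin

lemma bound_drift:
  assumes "f \<in> exp_schwartz a" "0 \<le> t"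
  shows "cmod (T k (drift l (\<sigma> * t) f)) \<le> C * ((1 + t) ^ K * gam_sum a K f)"
proof -
  have "a * \<bar>\<sigma> * t\<bar> - Im l * (\<sigma> * t) = 0"
    using im \<sigma> assms(2) by (simp add: abs_mult algebra_simps)
  moreover have "\<bar>\<sigma> * t\<bar> = t" using \<sigma> assms(2) by (simp add: abs_mult)
  ultimately have "gam_sum a K (drift l (\<sigma> * t) f) \<le> (1 + t) ^ K * gam_sum a K f"
    using gam_sum_drift_le[OF assms(1) a, of K l "\<sigma> * t"] by (simp only: exp_zero mult_1)
  then show ?thesis
    by (intro order_trans[OF bound[OF drift_exp_schwartz(1)[OF assms(1) a]]] mult_left_mono C)
qed

text \<open>Formally, \<open>T\<^sub>0 = exp (- t L) exp (t L) T\<^sub>0\<close> for \<open>L = \<sigma> (d/dx - \<i>l) + \<alpha>\<close>. The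
recurrence gives \<open>L^k T\<^sub>0 = A^k T\<^sub>k\<close>, so \<open>exp (t L) T\<^sub>0\<close> is the exponential series, and
\<open>exp (- t L)\<close> acts on test functions as the drift times \<open>exp (- \<alpha> t)\<close>. The rigorous form
is the Taylor expansion of \<open>s \<mapsto> exp (- \<alpha> s) * T 0 (drift l (\<sigma> * s) f)\<close>.\<close>

lemma drift_expansion:
  assumes f: "f \<in> exp_schwartz a" and t: "0 \<le> t"
  shows "T 0 f = exp (- of_real (\<alpha> * t)) * (\<Sum>k. (A * of_real t) ^ k / fact k * T k (drift l (\<sigma> * t) f))"
proof -
  define c where "c k s = exp (- of_real (\<alpha> * s)) * T k (drift l (\<sigma> * s) f)" for k s
  have "(\<lambda>k. (A * of_real t) ^ k / fact k * c k t) sums c 0 0"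
  proof (rule backward_taylor_series[OF _ _ t])
    fix k s assume s: "0 \<le> s" "s \<le> t"
    let ?g = "drift l (\<sigma> * s) f"
    have g: "?g \<in> exp_schwartz a" by (rule drift_exp_schwartz(1)[OF f a])
    have "((\<lambda>s. \<sigma> * s) has_vector_derivative \<sigma>) (at s)"
      by (auto intro!: derivative_eq_intros)
    moreover have "((\<lambda>t. T k (drift l t f)) has_vector_derivative T k (drift_gen l ?g)) (at (\<sigma> * s))"
      unfolding drift_drift_gen[OF exp_schwartz_bounds(1)[OF f], symmetric]
      by (rule functional_drift_derivative[where T = "T k", OF add scale bound C a f])
    ultimately have "((\<lambda>t. T k (drift l t f)) \<circ> (\<lambda>s. \<sigma> * s) has_vector_derivative
        \<sigma> *\<^sub>R T k (drift_gen l ?g)) (at s)"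
      by (rule vector_diff_chain_at)
    then
    have d1: "((\<lambda>s. T k (drift l (\<sigma> * s) f)) has_vector_derivative of_real \<sigma> * T k (drift_gen l ?g)) (at s)"
      by (simp only: o_def scaleR_conv_of_real)
    have d2: "((\<lambda>s. exp (- of_real (\<alpha> * s))) has_vector_derivative
        - of_real \<alpha> * exp (- complex_of_real (\<alpha> * s))) (at s)"
      unfolding of_real_mult by (rule has_vector_derivative_real_field) (auto intro!: derivative_eq_intros)
    show "(c k has_vector_derivative - A * c (Suc k) s) (at s)"
      using has_vector_derivative_mult[OF d2 d1] unfolding c_def step[OF g]
      by (simp add: algebra_simps)
    have "cmod (c k s) = exp (- (\<alpha> * s)) * cmod (T k ?g)" by (simp add: c_def norm_mult)
    also have "\<dots> \<le> exp (\<bar>\<alpha>\<bar> * t) * (C * ((1 + t) ^ K * gam_sum a K f))"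
    proof (intro mult_mono)
      have "- (\<alpha> * s) \<le> \<bar>\<alpha>\<bar> * s" using s abs_ge_minus_self[of "\<alpha> * s"] by (simp add: abs_mult)
      also have "\<dots> \<le> \<bar>\<alpha>\<bar> * t" using s by (intro mult_left_mono) auto
      finally show "exp (- (\<alpha> * s)) \<le> exp (\<bar>\<alpha>\<bar> * t)" by simp
      show "cmod (T k ?g) \<le> C * ((1 + t) ^ K * gam_sum a K f)"
        by (rule order_trans[OF bound_drift[OF f s(1)]])
           (intro mult_left_mono mult_right_mono power_mono gam_sum_nonneg f C; use s in simp)
    qed auto
    finally show "cmod (c k s) \<le> exp (\<bar>\<alpha>\<bar> * t) * (C * ((1 + t) ^ K * gam_sum a K f))" .
  qed
  then have "(\<lambda>k. exp (- of_real (\<alpha> * t)) * ((A * of_real t) ^ k / fact k * T k (drift l (\<sigma> * t) f))) sums T 0 f"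
    by (simp add: c_def mult_ac)
  moreover have "summable (\<lambda>k. (A * of_real t) ^ k / fact k * T k (drift l (\<sigma> * t) f))"
    by (rule exponential_series(1)[OF bound_drift[OF f t]])
  ultimately show ?thesis by (simp only: sums_iff suminf_mult)
qed

text \<open>Let \<open>t\<close> tend to infinity in the expansion: the series is at most \<open>exp (\<bar>A\<bar> t)\<close> times a
polynomial in \<open>t\<close>, and \<open>exp (- \<alpha> t)\<close> wins.\<close>

lemma vanishes:
  assumes "cmod A < \<alpha>" and f: "f \<in> exp_schwartz a"
  shows "T 0 f = 0"
proof -
  define b where "b = \<alpha> - cmod A"
  have b: "0 < b" using assms(1) by (simp add: b_def)
  have "cmod (T 0 f) \<le> C * gam_sum a K f * (exp (- (b * t)) * (1 + t) ^ K)" if t: "0 \<le> t" for t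
  proof -
    have "cmod (T 0 f) = exp (- (\<alpha> * t)) *
        cmod (\<Sum>k. (A * of_real t) ^ k / fact k * T k (drift l (\<sigma> * t) f))"
      unfolding drift_expansion[OF f t] norm_mult by simp
    also have "\<dots> \<le> exp (- (\<alpha> * t)) * (exp (cmod (A * of_real t)) * (C * ((1 + t) ^ K * gam_sum a K f)))"
      by (intro mult_left_mono exponential_series bound_drift f t) auto
    also have "\<dots> = (exp (- (\<alpha> * t)) * exp (cmod A * t)) * (C * ((1 + t) ^ K * gam_sum a K f))"
      using t by (simp add: norm_mult)
    also have "exp (- (\<alpha> * t)) * exp (cmod A * t) = exp (- (b * t))"
      by (simp add: b_def exp_add[symmetric] algebra_simps)
    finally show ?thesis by (simp add: mult_ac)
  qed
  then have ev: "\<forall>\<^sub>F t in at_top. cmod (T 0 f) \<le> C * gam_sum a K f * (exp (- (b * t)) * (1 + t) ^ K)"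
    using eventually_ge_at_top[of 0] by (rule eventually_mono[rotated])
  have "((\<lambda>t. exp (- (b * t)) * (1 + t) ^ K) \<longlongrightarrow> 0) at_top"
    using b by real_asymp
  from tendsto_mult_right_zero[OF this]
  have "((\<lambda>t. C * gam_sum a K f * (exp (- (b * t)) * (1 + t) ^ K)) \<longlongrightarrow> 0) at_top" .
  from tendsto_lowerbound[OF this ev] show ?thesis by simp
qed

text \<open>The transpose of \<open>\<sigma> (d/dx - \<i>l)\<close>, so that \<open>T\<close> solves \<open>T' = \<i>l T\<close> precisely when
it annihilates all values of \<open>defect\<close>.\<close>

definition defect :: "(real \<Rightarrow> complex) \<Rightarrow> real \<Rightarrow> complex" where
  "defect f = (\<lambda>x. - of_real \<sigma> * drift_gen l f x)"

lemma defect_exp_schwartz: "f \<in> exp_schwartz a \<Longrightarrow> (defect ^^ j) f \<in> exp_schwartz a"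
proof (induction j)
  case (Suc j)
  have "defect g \<in> exp_schwartz a" if "g \<in> exp_schwartz a" for g
    unfolding defect_def by (intro exp_schwartz_scale drift_gen_exp_schwartz that)
  with Suc show ?case by simp
qed simp

lemma functional_defect:
  "f \<in> exp_schwartz a \<Longrightarrow> T k (defect f) = A * T (Suc k) f - of_real \<alpha> * T k f"
  using step[of f k] scale[OF drift_gen_exp_schwartz[of f a l], of k "- of_real \<sigma>"] by (simp add: defect_def)

lemma drift_defect:
  assumes "f \<in> exp_schwartz a"
  shows "drift l t ((defect ^^ j) f) = (defect ^^ j) (drift l t f)"
proof (induction j)
  case (Suc j)
  have "drift l t (defect g) = defect (drift l t g)" if "g \<in> exp_schwartz a" for g
    using drift_drift_gen[OF exp_schwartz_bounds(1)[OF that], of l t]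
    by (simp add: defect_def drift_def fun_eq_iff algebra_simps)
  from this[OF defect_exp_schwartz[OF assms]] Suc show ?case by simp
qed simp

text \<open>For \<open>\<bar>A\<bar> = \<alpha>\<close> the exponentials in the expansion cancel and leave polynomial growth of order
\<open>t^K\<close>. Applying \<open>defect\<close> to the test function amounts to forming the differences
\<open>A T\<^sub>k\<^sub>+\<^sub>1 - \<alpha> T\<^sub>k\<close>, each of which gains a factor \<open>1 / sqrt t\<close>; with \<open>2 K + 1\<close> of
them the decay wins.\<close>

lemma power_of_defect_annihilated:
  assumes A: "cmod A = \<alpha>" and f: "f \<in> exp_schwartz a"
  shows "T 0 ((defect ^^ (2 * K + 1)) f) = 0"
proof -
  let ?N = "2 * K + 1"
  define M where "M = fact ?N * C * gam_sum a K f * exp \<alpha>"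
  have "cmod (T 0 ((defect ^^ ?N) f)) \<le> M * ((1 + t) ^ K / sqrt t ^ ?N)" if t: "4 \<le> t" for t
  proof -
    have t0: "0 \<le> t" using t by simp
    have g: "drift l (\<sigma> * t) f \<in> exp_schwartz a" by (rule drift_exp_schwartz(1)[OF f a])
    have "T 0 ((defect ^^ ?N) f) = exp (- of_real (\<alpha> * t)) *
        (\<Sum>k. (A * of_real t) ^ k / fact k * T k ((defect ^^ ?N) (drift l (\<sigma> * t) f)))"
      unfolding drift_defect[OF f, symmetric] by (rule drift_expansion[OF defect_exp_schwartz[OF f] t0])
    also have "cmod \<dots> \<le> fact ?N * (C * ((1 + t) ^ K * gam_sum a K f) * exp \<alpha>) / sqrt t ^ ?N"
      by (rule iterated_difference_decay[where e = "\<lambda>j k. T k ((defect ^^ j) (drift l (\<sigma> * t) f))"])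
         (simp_all add: functional_defect[OF defect_exp_schwartz[OF g]] bound_drift[OF f t0] A t)
    finally show ?thesis by (simp add: M_def mult_ac)
  qed
  then have ev: "\<forall>\<^sub>F t in at_top. cmod (T 0 ((defect ^^ ?N) f)) \<le> M * ((1 + t) ^ K / sqrt t ^ ?N)"
    using eventually_ge_at_top[of 4] by (rule eventually_mono[rotated])
  have "((\<lambda>t::real. (1 + t) ^ K / sqrt t ^ ?N) \<longlongrightarrow> 0) at_top" by real_asymp
  from tendsto_mult_right_zero[OF this]
  have "((\<lambda>t. M * ((1 + t) ^ K / sqrt t ^ ?N)) \<longlongrightarrow> 0) at_top" .
  from tendsto_lowerbound[OF this ev] show ?thesis by simp
qed

text \<open>If the square of \<open>defect\<close> is annihilated, \<open>(\<alpha> / A)^k\<close> times an affine function of \<open>k\<close>, with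
slope a multiple of \<open>T 0 (defect f)\<close>, gives \<open>T k f\<close>. Boundedness in \<open>k\<close> forces the slope to vanish.
This excludes generalized eigendistributions such as \<open>x exp (\<i>lx)\<close>.\<close>

lemma defect_descent:
  assumes A: "cmod A = \<alpha>" and f: "f \<in> exp_schwartz a"
    and zero: "\<And>k. T k (defect (defect f)) = 0"
  shows "T 0 (defect f) = 0"
proof (rule ccontr)
  let ?v = "T 0 (defect f)"
  assume v: "?v \<noteq> 0"
  have df: "defect f \<in> exp_schwartz a" using defect_exp_schwartz[OF f, of 1] by simp
  have vk: "A ^ k * T k (defect f) = of_real \<alpha> ^ k * ?v" for k
  proof (induction k)
    case (Suc k)
    have "A * T (Suc k) (defect f) = of_real \<alpha> * T k (defect f)"
      using functional_defect[OF df, of k] zero[of k] by simp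
    then have "A ^ Suc k * T (Suc k) (defect f) = of_real \<alpha> * (A ^ k * T k (defect f))"
      by (simp add: mult_ac)
    then show ?case by (simp add: Suc mult_ac)
  qed simp
  have uk: "of_real \<alpha> * (A ^ k * T k f) = of_real \<alpha> ^ k * (of_real \<alpha> * T 0 f + of_nat k * ?v)" for k
  proof (induction k)
    case (Suc k)
    have "A * T (Suc k) f = T k (defect f) + of_real \<alpha> * T k f"
      using functional_defect[OF f, of k] by simp
    then have "of_real \<alpha> * A ^ k * (A * T (Suc k) f) = of_real \<alpha> * A ^ k * (T k (defect f) + of_real \<alpha> * T k f)"
      by simp
    then have "of_real \<alpha> * (A ^ Suc k * T (Suc k) f)
        = of_real \<alpha> * (A ^ k * T k (defect f)) + of_real \<alpha> * (of_real \<alpha> * (A ^ k * T k f))"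
      by (simp add: algebra_simps)
    also have "\<dots> = of_real \<alpha> ^ Suc k * (of_real \<alpha> * T 0 f + of_nat (Suc k) * ?v)"
      unfolding vk Suc by (simp add: algebra_simps)
    finally show ?case .
  qed simp
  define Q where "Q = C * gam_sum a K f"
  have le: "real k * cmod ?v \<le> 2 * \<alpha> * Q" for k
  proof (cases "\<alpha> = 0")
    case True
    then have "A = 0" using A by simp
    with functional_defect[OF f, of 0] True v show ?thesis by simp
  next
    case False
    then have p: "0 < \<alpha> ^ k" "0 < \<alpha>" using A by (metis norm_ge_zero order_le_less zero_less_power)+
    have "\<alpha> * (\<alpha> ^ k * cmod (T k f)) = \<alpha> ^ k * cmod (of_real \<alpha> * T 0 f + of_nat k * ?v)"
      using arg_cong[OF uk[of k], of cmod] p by (simp add: norm_mult norm_power A)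
    then have "\<alpha> * cmod (T k f) = cmod (of_real \<alpha> * T 0 f + of_nat k * ?v)"
      using p by simp
    moreover have "cmod (of_nat k * ?v) \<le> cmod (of_real \<alpha> * T 0 f + of_nat k * ?v) + cmod (of_real \<alpha> * T 0 f)"
      by (metis add_diff_cancel_left' norm_triangle_ineq4)
    ultimately have "real k * cmod ?v \<le> \<alpha> * cmod (T k f) + \<alpha> * cmod (T 0 f)"
      using p by (simp add: norm_mult)
    also have "\<dots> \<le> \<alpha> * Q + \<alpha> * Q"
      unfolding Q_def using p by (intro add_mono mult_left_mono bound f) auto
    finally show ?thesis by (simp add: mult_ac)
  qed
  obtain k :: nat where "2 * \<alpha> * Q / cmod ?v < real k" using reals_Archimedean2 by blast
  then have "2 * \<alpha> * Q < real k * cmod ?v" using v by (simp add: divide_less_eq)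
  with le[of k] show False by simp
qed

lemma shifted: "damped_orbit a \<alpha> \<sigma> l A (\<lambda>n. T (k + n)) C K"
  by unfold_locales (use a \<sigma> im C add scale bound step in auto)

lemma eigen_equation:
  assumes A: "cmod A = \<alpha>" and f: "f \<in> exp_schwartz a"
  shows "T 0 (drift_gen l f) = 0"
proof -
  have "T k ((defect ^^ Suc j) f) = 0" if "j \<le> 2 * K" for j k
    using that
  proof (induction j arbitrary: k rule: inc_induct)
    case base
    interpret s: damped_orbit a \<alpha> \<sigma> l A "\<lambda>n. T (k + n)" C K by (rule shifted)
    show ?case using s.power_of_defect_annihilated[OF A f] by simp
  next
    case (step j)
    interpret s: damped_orbit a \<alpha> \<sigma> l A "\<lambda>n. T (k + n)" C K by (rule shifted)
    show ?case using s.defect_descent[OF A defect_exp_schwartz[OF f, of j]] step.IH by simp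
  qed
  from this[of 0 0] have "T 0 (defect f) = 0" by simp
  then show ?thesis
    using scale[OF drift_gen_exp_schwartz[OF f], of 0 "- of_real \<sigma>"] \<sigma> by (auto simp: defect_def)
qed

end

section \<open>Exponentials as distributions\<close>

text \<open>For \<open>\<bar>Im \<xi>\<bar> \<le> a\<close> this is the regular distribution \<open>exp (\<i>\<xi>x)\<close>, an eigendistribution of
\<open>d/dx\<close>.\<close>

definition fourier :: "complex \<Rightarrow> functional" where
  "fourier \<xi> f = (LINT x|lborel. exp (\<i> * \<xi> * of_real x) * f x)"

lemma lborel_integrable_inverse_1_plus_square: "integrable lborel (\<lambda>x::real. inverse (1 + x\<^sup>2))"
  using integrable_inverse_1_plus_square by (simp add: set_integrable_def)

lemma fourier_integrand_le:
  assumes f: "f \<in> exp_schwartz a" and \<xi>: "\<bar>Im \<xi>\<bar> \<le> a"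
  shows "cmod (exp (\<i> * \<xi> * of_real x) * f x) \<le> gam a 2 0 f * inverse (1 + x\<^sup>2)"
proof -
  have "- (Im \<xi> * x) \<le> \<bar>Im \<xi>\<bar> * \<bar>x\<bar>" using abs_ge_minus_self[of "Im \<xi> * x"] by (simp add: abs_mult)
  also have "\<dots> \<le> a * \<bar>x\<bar>" using \<xi> by (intro mult_right_mono) auto
  finally have e: "exp (- (Im \<xi> * x)) \<le> exp (a * \<bar>x\<bar>)" by simp
  have w: "1 + x\<^sup>2 \<le> (1 + \<bar>x\<bar>)\<^sup>2" by (simp add: power2_sum)
  have "(1 + x\<^sup>2) * cmod (exp (\<i> * \<xi> * of_real x) * f x) = exp (- (Im \<xi> * x)) * (1 + x\<^sup>2) * cmod (f x)"
    by (simp add: norm_mult)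
  also have "\<dots> \<le> weighted a 2 0 f x"
    unfolding weighted_def funpow_0 by (intro mult_mono e w) auto
  also have "\<dots> \<le> gam a 2 0 f" by (rule exp_schwartz_bounds[OF f])
  finally show ?thesis by (simp add: field_simps add_pos_nonneg)
qed

lemma exp_mult_has_vector_derivative:
  assumes "smooth f"
  shows "((\<lambda>x. exp (\<i> * \<xi> * of_real x) * f x) has_vector_derivative
      exp (\<i> * \<xi> * of_real x) * drift_gen \<xi> f x) (at x)"
proof -
  have "((\<lambda>s. exp (\<i> * \<xi> * of_real s)) has_vector_derivative \<i> * \<xi> * exp (\<i> * \<xi> * of_real x)) (at x)"
    by (rule has_vector_derivative_real_field) (auto intro!: derivative_eq_intros)
  from has_vector_derivative_mult[OF this smooth_has_vector_derivative[OF assms, of 0]]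
  show ?thesis by (simp add: drift_gen_def algebra_simps)
qed

lemma fourier_integrable:
  assumes f: "f \<in> exp_schwartz a" and \<xi>: "\<bar>Im \<xi>\<bar> \<le> a"
  shows "integrable lborel (\<lambda>x. exp (\<i> * \<xi> * of_real x) * f x)"
proof (rule Bochner_Integration.integrable_bound)
  show "integrable lborel (\<lambda>x. gam a 2 0 f * inverse (1 + x\<^sup>2))"
    using lborel_integrable_inverse_1_plus_square by simp
  have "continuous_on UNIV (\<lambda>x. exp (\<i> * \<xi> * of_real x) * f x)"
    using exp_mult_has_vector_derivative[OF exp_schwartz_bounds(1)[OF f]]
    by (intro continuous_at_imp_continuous_on ballI) (rule has_vector_derivative_continuous)
  then show "(\<lambda>x. exp (\<i> * \<xi> * of_real x) * f x) \<in> borel_measurable lborel"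
    by (simp add: borel_measurable_continuous_onI)
  show "AE x in lborel. norm (exp (\<i> * \<xi> * of_real x) * f x) \<le> norm (gam a 2 0 f * inverse (1 + x\<^sup>2))"
    using fourier_integrand_le[OF f \<xi>] by (auto intro!: AE_I2 order_trans[OF _ abs_ge_self])
qed

lemma fourier_le:
  assumes f: "f \<in> exp_schwartz a" and \<xi>: "\<bar>Im \<xi>\<bar> \<le> a"
  shows "cmod (fourier \<xi> f) \<le> (LINT x|lborel. inverse (1 + x\<^sup>2)) * gam a 2 0 f"
proof -
  have "cmod (fourier \<xi> f) \<le> (LINT x|lborel. gam a 2 0 f * inverse (1 + x\<^sup>2))"
    unfolding fourier_def
    by (rule Bochner_Integration.integral_norm_bound_integral[OF fourier_integrable[OF f \<xi>]])
       (use lborel_integrable_inverse_1_plus_square fourier_integrand_le[OF f \<xi>] in auto)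
  then show ?thesis by (simp add: mult.commute)
qed

lemma fourier_add:
  assumes "f \<in> exp_schwartz a" "g \<in> exp_schwartz a" "\<bar>Im \<xi>\<bar> \<le> a"
  shows "fourier \<xi> (\<lambda>x. f x + g x) = fourier \<xi> f + fourier \<xi> g"
  using Bochner_Integration.integral_add[OF assms(1,2)[THEN fourier_integrable, OF assms(3)]]
  by (simp add: fourier_def distrib_left)

lemma fourier_scale: "fourier \<xi> (\<lambda>x. c * f x) = c * fourier \<xi> f"
  by (simp add: fourier_def mult.left_commute[of _ c])

text \<open>The integrand is the derivative of \<open>exp (\<i>\<xi>x) * f x\<close>, which vanishes at both ends.\<close>

lemma fourier_drift_gen:
  assumes f: "f \<in> exp_schwartz a" and \<xi>: "\<bar>Im \<xi>\<bar> \<le> a"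
  shows "fourier \<xi> (drift_gen \<xi> f) = 0"
proof -
  let ?F = "\<lambda>x. exp (\<i> * \<xi> * of_real x) * f x"
  let ?F' = "\<lambda>x. exp (\<i> * \<xi> * of_real x) * drift_gen \<xi> f x"
  have Wf: "drift_gen \<xi> f \<in> exp_schwartz a" by (rule drift_gen_exp_schwartz[OF f])
  have lim: "(?F \<longlongrightarrow> 0) G" if "((\<lambda>x. inverse (1 + x\<^sup>2)) \<longlongrightarrow> 0) G" for G
    by (rule Lim_null_comparison[OF always_eventually[OF allI[OF fourier_integrand_le[OF f \<xi>]]]])
       (rule tendsto_mult_right_zero[OF that])
  have "(LBINT x=-\<infinity>..\<infinity>. ?F' x) = 0 - 0"
  proof (rule interval_integral_FTC_integrable)
    show "(?F has_vector_derivative ?F' x) (at x)" for x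
      by (rule exp_mult_has_vector_derivative[OF exp_schwartz_bounds(1)[OF f]])
    show "isCont ?F' x" for x
      by (rule has_vector_derivative_continuous[OF exp_mult_has_vector_derivative[OF exp_schwartz_bounds(1)[OF Wf]]])
    show "set_integrable lborel (einterval (-\<infinity>) \<infinity>) ?F'"
      using fourier_integrable[OF Wf \<xi>] by (simp add: set_integrable_def)
    have "((\<lambda>x::real. inverse (1 + x\<^sup>2)) \<longlongrightarrow> 0) at_bot" "((\<lambda>x::real. inverse (1 + x\<^sup>2)) \<longlongrightarrow> 0) at_top"
      by real_asymp+
    then show "((?F \<circ> real_of_ereal) \<longlongrightarrow> 0) (at_right (-\<infinity>))" "((?F \<circ> real_of_ereal) \<longlongrightarrow> 0) (at_left \<infinity>)"
      unfolding ereal_tendsto_simps using lim by blast+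
  qed simp
  then show ?thesis
    by (simp add: fourier_def interval_lebesgue_integral_def set_lebesgue_integral_def)
qed

lemma fourier_D:
  assumes f: "f \<in> exp_schwartz a" and \<xi>: "\<bar>Im \<xi>\<bar> \<le> a"
  shows "fourier \<xi> (D f) = - (\<i> * \<xi> * fourier \<xi> f)"
  using fourier_drift_gen[OF assms] fourier_add[OF exp_schwartz_D[OF f] exp_schwartz_scale[OF f] \<xi>, of "\<i> * \<xi>"]
  by (simp add: drift_gen_def fourier_scale eq_neg_iff_add_eq_0)

lemma poly_growth:
  fixes p :: "complex poly"
  obtains C d where "0 \<le> C" "\<And>x::real. cmod (poly p (of_real x)) \<le> C * (1 + \<bar>x\<bar>) ^ d"
proof -
  have "\<exists>C d. 0 \<le> C \<and> (\<forall>x::real. cmod (poly p (of_real x)) \<le> C * (1 + \<bar>x\<bar>) ^ d)"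
  proof (induction p)
    case 0
    show ?case by (intro exI[of _ 0]) auto
  next
    case (pCons c p)
    then obtain C d where C: "0 \<le> C" "\<And>x::real. cmod (poly p (of_real x)) \<le> C * (1 + \<bar>x\<bar>) ^ d" by blast
    have "cmod (poly (pCons c p) (of_real x)) \<le> (cmod c + C) * (1 + \<bar>x\<bar>) ^ Suc d" for x :: real
    proof -
      have "cmod (poly (pCons c p) (of_real x)) \<le> cmod c + \<bar>x\<bar> * cmod (poly p (of_real x))"
        by (metis norm_mult norm_of_real norm_triangle_ineq poly_pCons)
      also have "\<dots> \<le> cmod c * (1 + \<bar>x\<bar>) ^ Suc d + (1 + \<bar>x\<bar>) * (C * (1 + \<bar>x\<bar>) ^ d)"
      proof (intro add_mono mult_mono C)
        have "1 \<le> (1 + \<bar>x\<bar>) ^ Suc d" by (rule one_le_power) simp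
        then show "cmod c \<le> cmod c * (1 + \<bar>x\<bar>) ^ Suc d"
          using mult_left_mono[of 1 "(1 + \<bar>x\<bar>) ^ Suc d" "cmod c"] by simp
      qed auto
      finally show ?thesis by (simp add: algebra_simps)
    qed
    with C(1) show ?case by (intro exI[of _ "cmod c + C"] exI[of _ "Suc d"]) auto
  qed
  then show ?thesis using that by blast
qed

text \<open>The linear term is chosen to cancel the exponential in \<open>fourier \<xi>\<close>, whose value at this
function is therefore the integral of \<open>exp (- x^2)\<close>.\<close>

definition gaussian :: "complex \<Rightarrow> real \<Rightarrow> complex" where
  "gaussian \<xi> x = exp (- (of_real x)\<^sup>2 - \<i> * \<xi> * of_real x)"

lemma gaussian_exp_schwartz: "gaussian \<xi> \<in> exp_schwartz a"
proof -
  \<comment> \<open>The \<open>n\<close>-th derivative is a polynomial times the Gaussian; this recursion produces the polynomials.\<close>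
  define P where "P n = ((\<lambda>p. pderiv p + [:- (\<i> * \<xi>), - 2:] * p) ^^ n) 1" for n
  define F where "F n x = poly (P n) (of_real x) * gaussian \<xi> x" for n x
  have d: "(F n has_vector_derivative F (Suc n) x) (at x)" for n x
    unfolding F_def gaussian_def
  proof (rule has_vector_derivative_real_field)
    show "((\<lambda>z. poly (P n) z * exp (- z\<^sup>2 - \<i> * \<xi> * z)) has_field_derivative
       poly (P (Suc n)) (of_real x) * exp (- (of_real x)\<^sup>2 - \<i> * \<xi> * of_real x)) (at (of_real x))"
      by (rule derivative_eq_intros poly_DERIV refl)+ (simp add: P_def algebra_simps)
  qed
  have F0: "F 0 = gaussian \<xi>" by (simp add: F_def P_def fun_eq_iff)
  note tower = derivative_tower[of F, OF d, unfolded F0]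
  have "\<exists>B. \<forall>x. weighted a m n (gaussian \<xi>) x \<le> B" for m n
  proof -
    obtain C d where C: "0 \<le> C" "\<And>x::real. cmod (poly (P n) (of_real x)) \<le> C * (1 + \<bar>x\<bar>) ^ d"
      by (rule poly_growth[of "P n"]) blast
    define b where "b = real (m + d) + a + \<bar>Im \<xi>\<bar>"
    have "weighted a m n (gaussian \<xi>) x \<le> C * exp (b\<^sup>2 / 4)" for x
    proof -
      have g: "cmod (gaussian \<xi> x) \<le> exp (\<bar>Im \<xi>\<bar> * \<bar>x\<bar> - x\<^sup>2)"
        using abs_ge_self[of "Im \<xi> * x"] by (simp add: gaussian_def abs_mult power2_eq_square)
      have "(1 + \<bar>x\<bar>) ^ (m + d) \<le> exp \<bar>x\<bar> ^ (m + d)"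
        by (intro power_mono exp_ge_add_one_self) auto
      then have e: "(1 + \<bar>x\<bar>) ^ (m + d) \<le> exp (real (m + d) * \<bar>x\<bar>)"
        by (simp only: exp_of_nat_mult)
      have "weighted a m n (gaussian \<xi>) x
          = exp (a * \<bar>x\<bar>) * (1 + \<bar>x\<bar>) ^ m * (cmod (poly (P n) (of_real x)) * cmod (gaussian \<xi> x))"
        by (simp add: weighted_def tower F_def norm_mult)
      also have "\<dots> \<le> exp (a * \<bar>x\<bar>) * (1 + \<bar>x\<bar>) ^ m * ((C * (1 + \<bar>x\<bar>) ^ d) * exp (\<bar>Im \<xi>\<bar> * \<bar>x\<bar> - x\<^sup>2))"
        by (intro mult_left_mono mult_mono C g) (use C in auto)
      also have "\<dots> = C * (exp (a * \<bar>x\<bar>) * (1 + \<bar>x\<bar>) ^ (m + d) * exp (\<bar>Im \<xi>\<bar> * \<bar>x\<bar> - x\<^sup>2))"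
        by (simp add: power_add mult_ac)
      also have "\<dots> \<le> C * (exp (a * \<bar>x\<bar>) * exp (real (m + d) * \<bar>x\<bar>) * exp (\<bar>Im \<xi>\<bar> * \<bar>x\<bar> - x\<^sup>2))"
        by (intro mult_left_mono mult_right_mono e C) auto
      also have "\<dots> = C * exp (b * \<bar>x\<bar> - \<bar>x\<bar>\<^sup>2)"
        by (simp add: b_def exp_add[symmetric] exp_diff[symmetric] algebra_simps)
      also have "\<dots> \<le> C * exp (b\<^sup>2 / 4)"
      proof -
        have "0 \<le> (b / 2 - \<bar>x\<bar>)\<^sup>2" by simp
        then have "b * \<bar>x\<bar> - \<bar>x\<bar>\<^sup>2 \<le> b\<^sup>2 / 4" by (simp add: power2_diff power_divide)
        then show ?thesis using C(1) by (intro mult_left_mono) auto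
      qed
      finally show ?thesis .
    qed
    then show ?thesis by blast
  qed
  then obtain B where "\<And>m n x. weighted a m n (gaussian \<xi>) x \<le> B m n" by metis
  from exp_schwartzI[OF tower(2) this] show ?thesis .
qed

lemma fourier_gaussian: "fourier \<xi> (gaussian \<xi>) \<noteq> 0"
proof
  assume 0: "fourier \<xi> (gaussian \<xi>) = 0"
  have eq: "exp (\<i> * \<xi> * of_real x) * gaussian \<xi> x = of_real (exp (- x\<^sup>2))" for x :: real
    unfolding gaussian_def exp_add[symmetric] by (simp flip: exp_of_real)
  have int: "integrable lborel (\<lambda>x::real. exp (- x\<^sup>2))"
    using fourier_integrable[OF gaussian_exp_schwartz[of \<xi>] order_refl[of "\<bar>Im \<xi>\<bar>"]]
    unfolding eq by (simp add: complex_of_real_integrable_eq)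
  have "(LINT x|lborel. exp (- x\<^sup>2)) = (0::real)"
    using 0 by (simp add: fourier_def eq)
  then have "AE x::real in lborel. exp (- x\<^sup>2) = 0"
    using integral_nonneg_eq_0_iff_AE[OF int] by simp
  then have "AE x::real in lborel. False" by simp
  then show False by (simp add: eventually_False ae_filter_eq_bot_iff)
qed

lemma continuous_seminorm_gam: "continuous_seminorm a (gam a m n)"
proof -
  have le: "gam a m n g \<le> gam a m n f + gam a m n (\<lambda>x. g x - f x)"
    if "f \<in> exp_schwartz a" "g \<in> exp_schwartz a" for f g
    using gam_add[OF that(1) exp_schwartz_diff[OF that(2,1)], of m n] by simp
  have "continuous_map (exp_schwartz_topology a) euclideanreal (gam a m n)"
  proof (rule continuous_map_gam_bounded)
    fix f g assume fg: "f \<in> exp_schwartz a" "g \<in> exp_schwartz a"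
    show "dist (gam a m n g) (gam a m n f) \<le> 1 * gam a m n (\<lambda>x. g x - f x)"
      using le[OF fg] le[OF fg(2,1)] gam_minus_commute[OF fg, of m n] by (simp add: dist_real_def)
  qed
  then show ?thesis unfolding continuous_seminorm_def
    by (auto intro: gam_nonneg gam_add simp: gam_scale)
qed

lemma exp_tempered_gam_bounded:
  assumes add: "\<And>f g. f \<in> exp_schwartz a \<Longrightarrow> g \<in> exp_schwartz a \<Longrightarrow> T (\<lambda>x. f x + g x) = T f + T g"
    and scale: "\<And>c f. f \<in> exp_schwartz a \<Longrightarrow> T (\<lambda>x. c * f x) = c * T f"
    and bound: "\<And>f. f \<in> exp_schwartz a \<Longrightarrow> cmod (T f) \<le> C * gam a m n f"
  shows "exp_tempered a T"
proof -
  have "continuous_map (exp_schwartz_topology a) euclidean T"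
  proof (rule continuous_map_gam_bounded)
    fix f g assume fg: "f \<in> exp_schwartz a" "g \<in> exp_schwartz a"
    have "T (\<lambda>x. g x - f x) = T g - T f"
      using add[OF fg(2) exp_schwartz_scale[OF fg(1), of "-1"]] scale[OF fg(1), of "-1"] by simp
    then show "dist (T g) (T f) \<le> C * gam a m n (\<lambda>x. g x - f x)"
      using bound[OF exp_schwartz_diff[OF fg(2,1)]] by (simp add: dist_norm)
  qed
  then show ?thesis unfolding exp_tempered_def using add scale by blast
qed

text \<open>Eigendistributions with different eigenvalues are linearly independent: applying a vanishing
combination to \<open>drift_gen \<eta> f\<close> kills the \<open>\<eta>\<close> part, and the Gaussian detects what is left.\<close>

lemma fourier_sum_not_eigen:
  assumes \<xi>: "\<bar>Im \<xi>\<bar> \<le> a" and \<eta>: "\<bar>Im \<eta>\<bar> \<le> a" and ne: "\<xi> \<noteq> \<eta>"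
  shows "\<not> dist_eq a (dist_deriv (\<lambda>f. fourier \<xi> f + fourier \<eta> f)) (\<lambda>f. \<mu> * (fourier \<xi> f + fourier \<eta> f))"
proof
  assume eig: "dist_eq a (dist_deriv (\<lambda>f. fourier \<xi> f + fourier \<eta> f)) (\<lambda>f. \<mu> * (fourier \<xi> f + fourier \<eta> f))"
  have rel: "(\<i> * \<xi> - \<mu>) * fourier \<xi> f + (\<i> * \<eta> - \<mu>) * fourier \<eta> f = 0" if f: "f \<in> exp_schwartz a" for f
    using eig f unfolding dist_eq_def dist_deriv_def
    by (auto simp: fourier_D[OF f \<xi>] fourier_D[OF f \<eta>] algebra_simps)
  have coeff: "\<i> * \<xi> - \<mu> = 0"
    if \<xi>: "\<bar>Im \<xi>\<bar> \<le> a" and \<eta>: "\<bar>Im \<eta>\<bar> \<le> a" and ne: "\<xi> \<noteq> \<eta>"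
      and rel: "\<And>f. f \<in> exp_schwartz a \<Longrightarrow> (\<i> * \<xi> - \<mu>) * fourier \<xi> f + (\<i> * \<eta> - \<mu>) * fourier \<eta> f = 0"
    for \<xi> \<eta>
  proof -
    let ?f = "gaussian \<xi>"
    have f: "?f \<in> exp_schwartz a" by (rule gaussian_exp_schwartz)
    have "fourier \<xi> (drift_gen \<eta> ?f) = (\<i> * \<eta> - \<i> * \<xi>) * fourier \<xi> ?f"
      unfolding drift_gen_def fourier_add[OF exp_schwartz_D[OF f] exp_schwartz_scale[OF f] \<xi>] fourier_scale
        fourier_D[OF f \<xi>] by (simp add: algebra_simps)
    with rel[OF drift_gen_exp_schwartz[OF f, of \<eta>]] show ?thesis
      using ne by (simp add: fourier_drift_gen[OF f \<eta>] fourier_gaussian)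
  qed
  have "\<i> * \<xi> - \<mu> = 0" by (rule coeff[OF \<xi> \<eta> ne rel])
  moreover have "\<i> * \<eta> - \<mu> = 0"
    by (rule coeff[OF \<eta> \<xi> ne[symmetric]]) (use rel in \<open>simp add: add.commute\<close>)
  ultimately have "\<i> * \<xi> = \<i> * \<eta>" by simp
  with ne show False by simp
qed

text \<open>On \<open>exp (\<i>\<xi>x)\<close> the operator in the recurrence is multiplication by \<open>\<i>(\<xi> - l0) + \<beta>\<close> with
\<open>\<beta> = \<plusminus>\<alpha>\<close>. Moving \<open>\<xi>\<close> away from \<open>l0\<close> along the horizontal line by \<open>\<plusminus>s\<close> keeps it in the strip and
gives the multipliers \<open>\<beta> \<plusminus> \<i>s\<close>, both of modulus \<open>\<bar>A\<bar>\<close> for the \<open>s\<close> below. Hence the superposition of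
the two exponentials has a bounded orbit.\<close>

lemma bounded_orbit_not_eigen:
  fixes l0 A :: complex and \<alpha> :: real
  assumes a: "a = \<bar>Im l0\<bar>" "a \<noteq> 0" and \<alpha>: "0 < \<alpha>" "\<alpha> < cmod A"
  obtains T :: "int \<Rightarrow> functional" where "\<And>k. exp_tempered a (T k)" "recurrence l0 \<alpha> A T"
    "uniformly_bounded a T" "\<And>\<mu>. \<not> dist_eq a (dist_deriv (T 0)) (\<lambda>\<psi>. \<mu> * T 0 \<psi>)"
proof -
  define s where "s = sqrt ((cmod A)\<^sup>2 - \<alpha>\<^sup>2)"
  define \<beta> where "\<beta> = sgn (Im l0) * \<alpha>"
  define \<xi> where "\<xi> = l0 + of_real s"
  define \<eta> where "\<eta> = l0 - of_real s"
  define p where "p = Complex \<beta> s / A"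
  define q where "q = Complex \<beta> (- s) / A"
  define T :: "int \<Rightarrow> functional" where "T k f = p powi k * fourier \<xi> f + q powi k * fourier \<eta> f" for k f
  define P where "P = (LINT x|lborel. inverse (1 + (x::real)\<^sup>2))"
  have P: "0 \<le> P" unfolding P_def by (intro integral_nonneg_AE) auto
  have A: "A \<noteq> 0" using \<alpha> by auto
  have s: "0 < s" "s\<^sup>2 = (cmod A)\<^sup>2 - \<alpha>\<^sup>2"
    using \<alpha> power_strict_mono[of \<alpha> "cmod A" 2] by (auto simp: s_def)
  have \<beta>: "\<beta>\<^sup>2 = \<alpha>\<^sup>2" using a by (auto simp: \<beta>_def sgn_if)
  have im: "\<bar>Im \<xi>\<bar> \<le> a" "\<bar>Im \<eta>\<bar> \<le> a" by (auto simp: \<xi>_def \<eta>_def a)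
  have ne: "\<xi> \<noteq> \<eta>" using s by (simp add: \<xi>_def \<eta>_def)
  have n1: "cmod p = 1" "cmod q = 1"
  proof -
    have "cmod (Complex \<beta> s) = cmod A" "cmod (Complex \<beta> (- s)) = cmod A"
      using s(2) \<beta> by (simp_all add: complex_norm)
    then show "cmod p = 1" "cmod q = 1" using A by (simp_all add: p_def q_def norm_divide)
  qed
  then have pq: "p \<noteq> 0" "q \<noteq> 0" by auto
  have bound: "cmod (T k f) \<le> (2 * P + 1) * gam a 2 0 f" if f: "f \<in> exp_schwartz a" for k f
  proof -
    have "cmod (T k f) \<le> cmod (fourier \<xi> f) + cmod (fourier \<eta> f)"
      unfolding T_def by (rule order_trans[OF norm_triangle_ineq]) (simp add: norm_mult norm_power_int n1)
    also have "\<dots> \<le> P * gam a 2 0 f + P * gam a 2 0 f"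
      unfolding P_def by (intro add_mono fourier_le f im)
    also have "\<dots> \<le> (2 * P + 1) * gam a 2 0 f" using gam_nonneg[OF f] by (simp add: algebra_simps)
    finally show ?thesis .
  qed
  show ?thesis
  proof (rule that)
    show "exp_tempered a (T k)" for k
      by (rule exp_tempered_gam_bounded[OF _ _ bound])
         (simp_all add: T_def fourier_add[OF _ _ im(1)] fourier_add[OF _ _ im(2)] fourier_scale algebra_simps)
    show "uniformly_bounded a T" unfolding uniformly_bounded_def
      using continuous_seminorm_gam bound P
      by (intro exI[of _ "gam a 2 0"] exI[of _ "2 * P + 1"]) auto
    have rec: "dist_deriv (T k) f - \<i> * l0 * T k f + of_real \<beta> * T k f = A * T (k + 1) f"
      if f: "f \<in> exp_schwartz a" for k f
    proof -
      have Apq: "A * p = of_real \<beta> + \<i> * (\<xi> - l0)" "A * q = of_real \<beta> + \<i> * (\<eta> - l0)"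
        using A by (simp_all add: p_def q_def \<xi>_def \<eta>_def complex_eq_iff)
      have "A * T (k + 1) f = p powi k * (A * p) * fourier \<xi> f + q powi k * (A * q) * fourier \<eta> f"
        by (simp add: T_def power_int_add_1 pq ring_distribs(1) mult_ac(1,2,3))
      also have "\<dots> = dist_deriv (T k) f - \<i> * l0 * T k f + of_real \<beta> * T k f"
        unfolding Apq by (simp add: T_def dist_deriv_def fourier_D[OF f im(1)] fourier_D[OF f im(2)] algebra_simps)
      finally show ?thesis ..
    qed
    show "recurrence l0 \<alpha> A T" unfolding recurrence_def dist_eq_def a(1)[symmetric]
    proof (intro allI conjI impI ballI)
      fix k f assume "f \<in> exp_schwartz a"
      from rec[OF this, of k]
      show "dist_deriv (T k) f - \<i> * l0 * T k f + of_real \<alpha> * T k f = A * T (k + 1) f" if "0 < Im l0"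
        using that by (simp add: \<beta>_def)
      from rec[OF \<open>f \<in> exp_schwartz a\<close>, of k]
      show "dist_deriv (T k) f - \<i> * l0 * T k f - of_real \<alpha> * T k f = A * T (k + 1) f" if "Im l0 < 0"
        using that by (simp add: \<beta>_def)
    qed
    show "\<not> dist_eq a (dist_deriv (T 0)) (\<lambda>\<psi>. \<mu> * T 0 \<psi>)" for \<mu>
      using fourier_sum_not_eigen[OF im ne, of \<mu>] by (simp add: T_def[abs_def])
  qed
qed

section \<open>The three regimes\<close>

lemma damped_orbit_of_recurrence:
  assumes a: "a = \<bar>Im l0\<bar>" "a \<noteq> 0"
    and temp: "\<And>k. exp_tempered a (T k)" and rec: "recurrence l0 \<alpha> A T" and bdd: "uniformly_bounded a T"
  obtains C K where "\<And>k. damped_orbit a \<alpha> (sgn (Im l0)) l0 (of_real (sgn (Im l0)) * A) (\<lambda>n. T (k + int n)) C K"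
proof -
  obtain p M where p: "continuous_seminorm a p" and M: "0 < M"
    and bnd: "\<And>k f. f \<in> exp_schwartz a \<Longrightarrow> cmod (T k f) \<le> M * p f"
    using bdd unfolding uniformly_bounded_def by blast
  obtain K C where C: "0 < C" "\<And>f. f \<in> exp_schwartz a \<Longrightarrow> p f \<le> C * gam_sum a K f"
    by (rule continuous_seminorm_le_gam_sum[OF p]) blast
  have add: "T k (\<lambda>x. f x + g x) = T k f + T k g" if "f \<in> exp_schwartz a" "g \<in> exp_schwartz a" for k f g
    using temp[of k] that unfolding exp_tempered_def by blast
  have scale: "T k (\<lambda>x. c * f x) = c * T k f" if "f \<in> exp_schwartz a" for k f c
    using temp[of k] that unfolding exp_tempered_def by blast
  have "damped_orbit a \<alpha> (sgn (Im l0)) l0 (of_real (sgn (Im l0)) * A) (\<lambda>n. T (k + int n)) (M * C) K" for k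
  proof
    show "0 \<le> a" "\<bar>sgn (Im l0)\<bar> = 1" "sgn (Im l0) * Im l0 = a" using a by (auto simp: sgn_if)
    show "0 \<le> M * C" using M C by simp
    fix n f assume f: "f \<in> exp_schwartz a"
    show "cmod (T (k + int n) f) \<le> M * C * gam_sum a K f"
      unfolding mult.assoc
      by (rule order_trans[OF bnd[OF f] mult_left_mono[OF C(2)[OF f]]]) (use M in simp)
    have "T (k + int n) (drift_gen l0 f) = T (k + int n) (D f) + \<i> * l0 * T (k + int n) f"
      unfolding drift_gen_def add[OF exp_schwartz_D[OF f] exp_schwartz_scale[OF f]] scale[OF f] ..
    moreover have "k + int (Suc n) = k + int n + 1" by simp
    moreover have "Im l0 > 0 \<or> Im l0 < 0" using a by auto
    ultimately show "of_real (sgn (Im l0)) * T (k + int n) (drift_gen l0 f)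
        = of_real \<alpha> * T (k + int n) f - of_real (sgn (Im l0)) * A * T (k + int (Suc n)) f"
      using rec f unfolding recurrence_def dist_eq_def dist_deriv_def a(1)[symmetric]
      by (auto simp: algebra_simps dest!: spec[of _ "k + int n"] bspec[of _ _ f])
  qed (use add scale in auto)
  then show ?thesis by (rule that)
qed

theorem theorem3p1:
  fixes l0 A :: complex and \<alpha> a :: real
  assumes "a = \<bar>Im l0\<bar>" and "a \<noteq> 0" and "\<alpha> > 0" and "A \<noteq> 0"
  shows "(cmod A = \<alpha> \<longrightarrow>
            (\<forall>T :: int \<Rightarrow> functional.
               (\<forall>k. exp_tempered a (T k)) \<and> recurrence l0 \<alpha> A T \<and> uniformly_bounded a T \<longrightarrow>
               dist_eq a (dist_deriv (T 0)) (\<lambda>\<psi>. \<i> * l0 * T 0 \<psi>)))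
       \<and> (cmod A < \<alpha> \<longrightarrow>
            (\<forall>T :: int \<Rightarrow> functional.
               (\<forall>k. exp_tempered a (T k)) \<and> recurrence l0 \<alpha> A T \<and> uniformly_bounded a T \<longrightarrow>
               (\<forall>k. dist_eq a (T k) (\<lambda>\<psi>. 0))))
       \<and> (cmod A > \<alpha> \<longrightarrow>
            (\<exists>T :: int \<Rightarrow> functional.
               (\<forall>k. exp_tempered a (T k)) \<and> recurrence l0 \<alpha> A T \<and> uniformly_bounded a T \<and>
               \<not> (\<exists>\<mu>. dist_eq a (dist_deriv (T 0)) (\<lambda>\<psi>. \<mu> * T 0 \<psi>))))"
proof (intro conjI impI allI)
  have norm: "cmod (of_real (sgn (Im l0)) * A) = cmod A"
    using assms(1,2) by (auto simp: norm_mult sgn_if)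
  {
    fix T assume T: "(\<forall>k. exp_tempered a (T k)) \<and> recurrence l0 \<alpha> A T \<and> uniformly_bounded a T"
    then obtain C K where orb: "\<And>k. damped_orbit a \<alpha> (sgn (Im l0)) l0 (of_real (sgn (Im l0)) * A)
        (\<lambda>n. T (k + int n)) C K"
      using damped_orbit_of_recurrence[OF assms(1,2), of T \<alpha> A] by blast
    show "dist_eq a (dist_deriv (T 0)) (\<lambda>\<psi>. \<i> * l0 * T 0 \<psi>)" if "cmod A = \<alpha>"
      unfolding dist_eq_def dist_deriv_def
    proof
      fix f assume f: "f \<in> exp_schwartz a"
      have "T 0 (drift_gen l0 f) = 0"
        using damped_orbit.eigen_equation[OF orb[of 0] _ f] norm that by simp
      moreover have "T 0 (drift_gen l0 f) = T 0 (D f) + \<i> * l0 * T 0 f"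
        using damped_orbit.add[OF orb[of 0] exp_schwartz_D[OF f] exp_schwartz_scale[OF f], of 0 "\<i> * l0"]
          damped_orbit.scale[OF orb[of 0] f, of 0 "\<i> * l0"] by (simp add: drift_gen_def)
      ultimately show "- T 0 (D f) = \<i> * l0 * T 0 f" by (simp add: neg_eq_iff_add_eq_0)
    qed
    show "dist_eq a (T k) (\<lambda>\<psi>. 0)" if "cmod A < \<alpha>" for k
      unfolding dist_eq_def using damped_orbit.vanishes[OF orb[of k]] norm that by simp
  }
  show "\<exists>T :: int \<Rightarrow> functional.
      (\<forall>k. exp_tempered a (T k)) \<and> recurrence l0 \<alpha> A T \<and> uniformly_bounded a T \<and>
      \<not> (\<exists>\<mu>. dist_eq a (dist_deriv (T 0)) (\<lambda>\<psi>. \<mu> * T 0 \<psi>))" if "cmod A > \<alpha>"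
    using bounded_orbit_not_eigen[OF assms(1-3) that] by metis
qed

end
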